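(* Let $m,n\ge 1$ be integers and let $W$ be any strictly positive edge-weight function on the cylindrical Fisher graph of height $m$ and circumference $n$, with characteristic polynomial $P(z)=\det K(z)$. Then the set $\{z\in\mathbb{C}: P(z)=0,\ |z|=1\}$ is either empty or consists of a single real point (i.e. it is $\emptyset$, $\{1\}$ or $\{-1\}$).
   Context: The Fisher graph is the honeycomb lattice with every vertex replaced by a triangle. The cylindrical Fisher graph of height $m$ and circumference $n$ (the quotient of a Fisher graph that is finite in one direction and periodic in the other) has vertices $\beta_s(x,y),\omega_s(x,y)$ with $s\in\{a,b,c\}$, $x\in\mathbb{Z}/n\mathbb{Z}$, $y\in\{0,\dots,m-1\}$, so $6mn$ vertices in total. Its oriented edges are: triangular edges $\beta_a\to\beta_b\to\beta_c\to\beta_a$ and $\omega_a\to\omega_b\to\omega_c\to\omega_a$ at each $(x,y)$; and non-triangular edges: $a$-edges $\beta_a(x,y)\to\omega_a(x,y)$, $b$-edges $\beta_b(x,y)\to\omega_b(x+1,y)$, and $c$-edges $\beta_c(x,y)\to\omega_c(x,y+1)$ for $0\le y\le m-2$. Each edge $e$ has a weight $W(e)>0$. Call the $m$ $b$-edges from $x=n-1$ to $x=0$ the $z$-edges. For $z\in\mathbb{C}\setminus\{0\}$, $K(z)$ is the $6mn\times 6mn$ matrix indexed by vertices such that for each oriented edge $u\to v$: $K(z)_{u,v}=W(uv)$ and $K(z)_{v,u}=-W(uv)$ if $uv$ is not a $z$-edge, and $K(z)_{u,v}=zW(uv)$, $K(z)_{v,u}=-z^{-1}W(uv)$ if $uv$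 is a $z$-edge; all other entries are $0$. $P(z)=\det K(z)$. *)

theory Defs
  imports Complex_Main "Jordan_Normal_Form.Determinant"
begin

datatype dir = Dir_a | Dir_b | Dir_c

primrec next_dir :: "dir \<Rightarrow> dir" where
  "next_dir Dir_a = Dir_b"
| "next_dir Dir_b = Dir_c"
| "next_dir Dir_c = Dir_a"

text \<open>
  \<open>Beta s x y\<close> and \<open>Omega s x y\<close> stand for the vertices $\beta_s(x,y)$ and $\omega_s(x,y)$.
  The first coordinate is an element of Z/nZ, represented by its residue in \<open>{0..<n}\<close>.
\<close>

datatype vertex = Beta dir nat nat | Omega dir nat nat

definition fisher_vertices :: "nat \<Rightarrow> nat \<Rightarrow> vertex set" where
  "fisher_vertices m n =
     {Beta s x y | s x y. x < n \<and> y < m} \<union> {Omega s x y | s x y. x < n \<and> y < m}"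

inductive fisher_edge :: "nat \<Rightarrow> nat \<Rightarrow> vertex \<Rightarrow> vertex \<Rightarrow> bool" for m n :: nat where
  beta_triangle:
    "x < n \<Longrightarrow> y < m \<Longrightarrow> fisher_edge m n (Beta s x y) (Beta (next_dir s) x y)"
| omega_triangle:
    "x < n \<Longrightarrow> y < m \<Longrightarrow> fisher_edge m n (Omega s x y) (Omega (next_dir s) x y)"
| a_edge:
    "x < n \<Longrightarrow> y < m \<Longrightarrow> fisher_edge m n (Beta Dir_a x y) (Omega Dir_a x y)"
| b_edge:
    "x < n \<Longrightarrow> y < m \<Longrightarrow> fisher_edge m n (Beta Dir_b x y) (Omega Dir_b ((x + 1) mod n) y)"
| c_edge:
    "x < n \<Longrightarrow> y + 1 < m \<Longrightarrow> fisher_edge m n (Beta Dir_c x y) (Omega Dir_c x (y + 1))"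

definition z_edge :: "nat \<Rightarrow> nat \<Rightarrow> vertex \<Rightarrow> vertex \<Rightarrow> bool" where
  "z_edge m n u v \<longleftrightarrow> (\<exists>y<m. u = Beta Dir_b (n - 1) y \<and> v = Omega Dir_b 0 y)"

lemma z_edge_imp_fisher_edge: "0 < n \<Longrightarrow> z_edge m n u v \<Longrightarrow> fisher_edge m n u v"
  using b_edge[of "n - 1" n _ m] by (auto simp: z_edge_def)

lemma fisher_edge_in_vertices:
  "fisher_edge m n u v \<Longrightarrow> u \<in> fisher_vertices m n \<and> v \<in> fisher_vertices m n"
  by (induction rule: fisher_edge.induct) (auto simp: fisher_vertices_def)

text \<open>
  No two edges join the same pair of vertices, also when \<open>n = 1\<close>, so an oriented edge may be
  identified with its pair of endpoints, and the case distinction in \<open>kasteleyn_entry\<close>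
  does not depend on the order of its cases.
\<close>

lemma next_dir_neq [simp]:
  "next_dir s \<noteq> s" "s \<noteq> next_dir s" "next_dir (next_dir s) \<noteq> s" "s \<noteq> next_dir (next_dir s)"
  by (cases s; simp)+

lemma fisher_edge_asym: "fisher_edge m n u v \<Longrightarrow> \<not> fisher_edge m n v u"
  by (auto elim!: fisher_edge.cases)

definition kasteleyn_entry ::
  "nat \<Rightarrow> nat \<Rightarrow> (vertex \<Rightarrow> vertex \<Rightarrow> real) \<Rightarrow> complex \<Rightarrow> vertex \<Rightarrow> vertex \<Rightarrow> complex" where
  "kasteleyn_entry m n W z u v =
     (if fisher_edge m n u v then
        (if z_edge m n u v then z * of_real (W u v) else of_real (W u v))
      else if fisher_edge m n v u then
        (if z_edge m n v u then - inverse z * of_real (W v u) else - of_real (W v u))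
      else 0)"

text \<open>
  The matrices of the library are indexed by initial segments of the naturals, so the vertices
  are enumerated in a fixed order, used for rows and columns alike; the determinant does not
  depend on this order.
\<close>

definition vertex_list :: "nat \<Rightarrow> nat \<Rightarrow> vertex list" where
  "vertex_list m n =
     [V s x y. y \<leftarrow> [0..<m], x \<leftarrow> [0..<n], V \<leftarrow> [Beta, Omega], s \<leftarrow> [Dir_a, Dir_b, Dir_c]]"

lemma set_vertex_list: "set (vertex_list m n) = fisher_vertices m n"
proof -
  have "s \<in> {Dir_a, Dir_b, Dir_c}" for s
    by (cases s) auto
  then show ?thesis
    by (fastforce simp: vertex_list_def fisher_vertices_def)
qed

lemma length_vertex_list: "length (vertex_list m n) = 6 * m * n"
  by (simp add: vertex_list_def length_concat comp_def sum_list_triv)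

lemma card_fisher_vertices: "card (fisher_vertices m n) = 6 * m * n"
proof -
  have dirs: "(UNIV :: dir set) = {Dir_a, Dir_b, Dir_c}"
    using dir.exhaust by auto
  define A where "A = (UNIV :: dir set) \<times> {..<n} \<times> {..<m}"
  have fin: "finite A" and cA: "card A = 3 * m * n"
    by (auto simp: A_def dirs card_cartesian_product)
  let ?b = "\<lambda>(s, x, y). Beta s x y" and ?o = "\<lambda>(s, x, y). Omega s x y"
  have eq: "fisher_vertices m n = ?b ` A \<union> ?o ` A"
    by (force simp: fisher_vertices_def A_def)
  have "card (?b ` A) = card A" "card (?o ` A) = card A"
    by (rule card_image, auto simp: inj_on_def)+
  moreover have "?b ` A \<inter> ?o ` A = {}"
    by auto
  ultimately show ?thesis
    using fin cA by (simp add: eq card_Un_disjoint)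
qed

lemma distinct_vertex_list: "distinct (vertex_list m n)"
  by (rule card_distinct) (simp add: set_vertex_list card_fisher_vertices length_vertex_list)

definition kasteleyn_matrix ::
  "nat \<Rightarrow> nat \<Rightarrow> (vertex \<Rightarrow> vertex \<Rightarrow> real) \<Rightarrow> complex \<Rightarrow> complex mat" where
  "kasteleyn_matrix m n W z =
     mat (6 * m * n) (6 * m * n)
       (\<lambda>(i, j). kasteleyn_entry m n W z (vertex_list m n ! i) (vertex_list m n ! j))"

definition char_fun ::
  "nat \<Rightarrow> nat \<Rightarrow> (vertex \<Rightarrow> vertex \<Rightarrow> real) \<Rightarrow> complex \<Rightarrow> complex" where
  "char_fun m n W z = det (kasteleyn_matrix m n W z)"

end

theory Submission
  imports Defs "HOL-Analysis.Function_Topology"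
begin

text \<open>
  On the unit circle every zero of $P$ equals $(-1)^n$. A kernel vector $f$ of $K(z)$ assigns to
  each vertical cut through the $m$ $b$-edges between two columns a fermion, that is, a linear
  combination $\Psi_x$ of creation and annihilation operators on the $2^m$ sets of $b$-edges.
  The dimer transfer matrix $V_x$ of a column satisfies $V_x \Psi_x = -\Psi_{x+1} V_x$; this is a
  telescoping consequence of the equations $K(z) f = 0$ along the column. A full turn gives
  $V \Psi = \lambda \Psi V$ with $\lambda = (-1)^n z$. The matrix $V$ preserves the parity of
  the number of edges and is strictly positive on each of the two parity sectors. Let $\phi$ and
  $\psi$ be the right and left Perron vectors of the sector with the larger Perron value. If
  $|\lambda| = 1$ and $\lambda \neq 1$, then $\Psi \phi$ and $\psi \Psi$ would be peripheral
  eigenvectors in the other sector with an eigenvalue that is not positive, so both vanish. Hence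
  $\psi (\Psi c + c \Psi) \phi = 0$ for every creation or annihilation operator $c$, and as the
  anticommutators are the coefficients of $\Psi$ and $\psi \phi > 0$, this forces $\Psi = 0$.
  If this happens at every cut, then $f = 0$.
\<close>

section \<open>Perron vectors\<close>

lemma continuous_on_Min_image:
  fixes f :: "'i \<Rightarrow> 'x::topological_space \<Rightarrow> real"
  assumes "finite S" "S \<noteq> {}" "\<And>i. i \<in> S \<Longrightarrow> continuous_on K (f i)"
  shows "continuous_on K (\<lambda>x. Min ((\<lambda>i. f i x) ` S))"
  using assms
proof (induction S rule: finite_ne_induct)
  case (insert i S)
  then have "continuous_on K (\<lambda>x. min (f i x) (Min ((\<lambda>i. f i x) ` S)))"
    by (intro continuous_on_min) auto
  moreover have "Min ((\<lambda>i. f i x) ` insert i S) = min (f i x) (Min ((\<lambda>i. f i x) ` S))" for x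
    using insert.hyps by simp
  ultimately show ?case
    by simp
qed simp

lemma compact_standard_simplex:
  fixes S :: "'i set"
  assumes "finite S"
  shows "compact {x :: 'i \<Rightarrow> real. (\<forall>i. x i \<in> (if i \<in> S then {0..1} else {0})) \<and> sum x S = 1}"
proof -
  let ?P = "PiE UNIV (\<lambda>i. if i \<in> S then {0..1} else {0 :: real})"
  have "compactin (product_topology (\<lambda>i. euclidean) UNIV) ?P"
    by (subst compactin_PiE) (auto simp: compactin_euclidean_iff)
  then have "compact ?P"
    by (simp add: euclidean_product_topology compactin_euclidean_iff)
  moreover have "closed {x :: 'i \<Rightarrow> real. sum x S = 1}"
    by (intro closed_Collect_eq continuous_on_sum continuous_on_const continuous_on_product_coordinates)
  ultimately have "compact (?P \<inter> {x. sum x S = 1})"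
    by (rule compact_Int_closed)
  moreover have "?P \<inter> {x. sum x S = 1}
      = {x. (\<forall>i. x i \<in> (if i \<in> S then {0..1} else {0})) \<and> sum x S = 1}"
    unfolding PiE_UNIV_domain Pi_def by blast
  ultimately show ?thesis
    by simp
qed

text \<open>
  The Perron vector is found by maximising the Collatz--Wielandt ratio of \<open>A x\<close>; applying
  \<open>A\<close> once keeps all denominators positive on the whole simplex.
\<close>

lemma perron_eigenvector:
  fixes A :: "'i \<Rightarrow> 'i \<Rightarrow> real"
  assumes fin: "finite S" and ne: "S \<noteq> {}"
    and pos: "\<And>i j. i \<in> S \<Longrightarrow> j \<in> S \<Longrightarrow> A i j > 0"
  obtains r \<phi> where "r > 0" "\<And>i. i \<in> S \<Longrightarrow> \<phi> i > 0"
    "\<And>i. i \<in> S \<Longrightarrow> (\<Sum>j\<in>S. A i j * \<phi> j) = r * \<phi> i"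
proof -
  define K where
    "K = {x :: 'i \<Rightarrow> real. (\<forall>i. x i \<in> (if i \<in> S then {0..1} else {0})) \<and> sum x S = 1}"
  define B where "B x i = (\<Sum>j\<in>S. A i j * x j)" for x i
  define \<rho> where "\<rho> x = Min ((\<lambda>i. B (B x) i / B x i) ` S)" for x
  have B_pos: "B x i > 0" if i: "i \<in> S" and nn: "\<And>j. j \<in> S \<Longrightarrow> x j \<ge> 0" and ex: "\<exists>j\<in>S. x j > 0"
    for x i
  proof -
    from ex obtain j where j: "j \<in> S" "x j > 0" by blast
    show ?thesis
      unfolding B_def
      by (rule sum_pos2[OF fin j(1)]) (use i nn pos j in \<open>auto intro!: mult_nonneg_nonneg simp: less_imp_le\<close>)
  qed
  have normalised: "(\<lambda>i. if i \<in> S then y i / sum y S else 0) \<in> K"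
    if y: "\<And>i. i \<in> S \<Longrightarrow> y i > 0" for y
  proof -
    have s: "sum y S > 0"
      using y fin ne by (intro sum_pos) auto
    have "y i \<le> sum y S" if "i \<in> S" for i
      using y that fin by (intro member_le_sum) (auto simp: less_imp_le)
    moreover have "(\<Sum>i\<in>S. if i \<in> S then y i / sum y S else 0) = 1"
      using s by (simp add: sum_divide_distrib[symmetric])
    ultimately show ?thesis
      using s y by (auto simp: K_def less_imp_le)
  qed
  have K_B_pos: "B x i > 0" if "x \<in> K" "i \<in> S" for x i
  proof (rule B_pos[OF that(2)])
    show nn: "x j \<ge> 0" if "j \<in> S" for j
      using that \<open>x \<in> K\<close> by (auto simp: K_def dest: spec[of _ j])
    show "\<exists>j\<in>S. x j > 0"
    proof (rule ccontr)
      assume "\<not> ?thesis"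
      then have "sum x S \<le> 0"
        by (intro sum_nonpos) (auto simp: not_less)
      then show False using \<open>x \<in> K\<close> by (simp add: K_def)
    qed
  qed
  have cont_B: "continuous_on X (\<lambda>x. B x i)" for X i
    unfolding B_def
    by (intro continuous_on_sum continuous_on_mult_left
          continuous_on_subset[OF continuous_on_product_coordinates subset_UNIV])
  have cont_BB: "continuous_on X (\<lambda>x. B (B x) i)" for X i
    unfolding B_def[of "B _"] by (intro continuous_on_sum continuous_on_mult_left cont_B)
  have "continuous_on K \<rho>"
    unfolding \<rho>_def
    by (intro continuous_on_Min_image continuous_on_divide cont_B cont_BB fin ne)
       (use K_B_pos in force)
  moreover have "compact K"
    unfolding K_def by (rule compact_standard_simplex[OF fin])
  moreover have "K \<noteq> {}"
    using normalised[of "\<lambda>_. 1"] by auto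
  ultimately obtain x where x: "x \<in> K" and max: "\<And>x'. x' \<in> K \<Longrightarrow> \<rho> x' \<le> \<rho> x"
    using continuous_attains_sup by metis
  define y where "y = B x"
  define r where "r = \<rho> x"
  have y_pos: "y i > 0" if "i \<in> S" for i
    using K_B_pos[OF x that] by (simp add: y_def)
  define z where "z = B y"
  have z_pos: "z i > 0" if "i \<in> S" for i
    unfolding z_def using y_pos ne by (intro B_pos[OF that]) (auto simp: less_imp_le)
  have ge: "r * y i \<le> z i" if "i \<in> S" for i
  proof -
    have "r \<le> z i / y i"
      unfolding r_def \<rho>_def z_def y_def using fin that by (intro Min_le) auto
    then show ?thesis using y_pos[OF that] by (simp add: field_simps)
  qed
  have eq: "z i = r * y i" if i: "i \<in> S" for i
  proof (rule ccontr)
    assume "z i \<noteq> r * y i"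
    then have strict: "z i - r * y i > 0" using ge[OF i] by simp
    have Bz: "B z k > r * z k" if k: "k \<in> S" for k
    proof -
      have "B (\<lambda>j. z j - r * y j) k > 0"
        by (rule B_pos[OF k]) (use ge strict i in auto)
      moreover have "B (\<lambda>j. z j - r * y j) k = B z k - r * z k"
        unfolding z_def B_def
        by (simp add: right_diff_distrib sum_subtractf sum_distrib_left mult.left_commute)
      ultimately show ?thesis by simp
    qed
    define s where "s = sum y S"
    have s: "s > 0" unfolding s_def using y_pos fin ne by (intro sum_pos) auto
    define x' where "x' = (\<lambda>i. if i \<in> S then y i / s else 0)"
    have "x' \<in> K" unfolding x'_def s_def by (rule normalised) (rule y_pos)
    then have "\<rho> x' \<le> r" using max by (simp add: r_def)
    have Bx': "B x' k = z k / s" for k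
      unfolding B_def x'_def z_def by (simp add: sum_divide_distrib)
    have "B (B x') k / B x' k = B z k / z k" for k
      unfolding Bx' using s by (simp add: B_def Bx' sum_divide_distrib[symmetric])
    then have "\<rho> x' = Min ((\<lambda>k. B z k / z k) ` S)"
      by (simp add: \<rho>_def)
    also have "\<dots> > r"
      using Bz z_pos fin ne by (simp add: less_divide_eq)
    finally show False using \<open>\<rho> x' \<le> r\<close> by simp
  qed
  obtain i where i: "i \<in> S" using ne by blast
  have "r > 0" using eq[OF i] z_pos[OF i] y_pos[OF i] by (simp add: zero_less_mult_iff)
  moreover have "(\<Sum>j\<in>S. A i j * y j) = r * y i" if "i \<in> S" for i
    using eq[OF that] by (simp add: z_def B_def)
  ultimately show ?thesis
    using that y_pos by blast
qed

lemma perron_peripheral_eigenvalue: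
  fixes A :: "'i \<Rightarrow> 'i \<Rightarrow> real" and w :: "'i \<Rightarrow> complex"
  assumes fin: "finite S"
    and pos: "\<And>i j. i \<in> S \<Longrightarrow> j \<in> S \<Longrightarrow> A i j > 0"
    and \<psi>: "\<And>i. i \<in> S \<Longrightarrow> \<psi> i > 0"
      "\<And>j. j \<in> S \<Longrightarrow> (\<Sum>i\<in>S. \<psi> i * A i j) = \<mu> * \<psi> j"
    and w: "\<And>i. i \<in> S \<Longrightarrow> (\<Sum>j\<in>S. of_real (A i j) * w j) = \<kappa> * w i"
    and \<kappa>: "\<mu> \<le> cmod \<kappa>"
    and k: "k \<in> S" "w k \<noteq> 0"
  shows "\<kappa> = of_real (cmod \<kappa>)"
proof (cases "\<kappa> = 0")
  case False
  define D where "D i = (\<Sum>j\<in>S. A i j * cmod (w j)) - cmod \<kappa> * cmod (w i)" for i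
  have D_nonneg: "D i \<ge> 0" if "i \<in> S" for i
  proof -
    have "cmod (\<kappa> * w i) \<le> (\<Sum>j\<in>S. cmod (of_real (A i j) * w j))"
      unfolding w[OF that, symmetric] by (rule norm_sum)
    also have "\<dots> = (\<Sum>j\<in>S. A i j * cmod (w j))"
      using pos that by (intro sum.cong) (auto simp: norm_mult less_imp_le)
    finally show ?thesis by (simp add: D_def norm_mult)
  qed
  have "(\<Sum>i\<in>S. \<psi> i * (\<Sum>j\<in>S. A i j * cmod (w j)))
      = (\<Sum>j\<in>S. \<Sum>i\<in>S. \<psi> i * A i j * cmod (w j))"
    by (subst sum.swap) (simp add: sum_distrib_left mult.assoc)
  also have "\<dots> = (\<Sum>j\<in>S. \<mu> * \<psi> j * cmod (w j))"
    by (intro sum.cong refl) (simp add: sum_distrib_right[symmetric] \<psi>(2))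
  finally have "(\<Sum>i\<in>S. \<psi> i * D i) = (\<mu> - cmod \<kappa>) * (\<Sum>i\<in>S. \<psi> i * cmod (w i))"
    by (simp add: D_def right_diff_distrib sum_subtractf sum_distrib_left left_diff_distrib mult_ac)
  also have "\<dots> \<le> 0"
    using \<kappa> \<psi>(1) by (intro mult_nonpos_nonneg sum_nonneg) (auto simp: less_imp_le)
  finally have "(\<Sum>i\<in>S. \<psi> i * D i) = 0"
    using D_nonneg \<psi>(1) by (intro antisym sum_nonneg) (auto simp: less_imp_le)
  then have "D k = 0"
    using D_nonneg \<psi>(1) k fin by (subst (asm) sum_nonneg_eq_0_iff) (force simp: less_imp_le)+
  define \<omega> where "\<omega> = \<kappa> * w k / of_real (cmod (\<kappa> * w k))"
  have \<omega>: "cmod \<omega> = 1"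
    using False k by (simp add: \<omega>_def norm_divide norm_mult)
  then have \<omega>': "\<omega> * cnj \<omega> = 1"
    by (simp add: complex_norm_square[symmetric])
  have row: "(\<Sum>j\<in>S. of_real (A k j) * w j) = \<omega> * of_real (\<Sum>j\<in>S. A k j * cmod (w j))"
  proof -
    have "(\<Sum>j\<in>S. A k j * cmod (w j)) = cmod (\<kappa> * w k)"
      using \<open>D k = 0\<close> by (simp add: D_def norm_mult)
    then show ?thesis
      using False k w[OF k(1)] by (simp add: \<omega>_def)
  qed
  have "(\<Sum>j\<in>S. A k j * (cmod (w j) - Re (cnj \<omega> * w j)))
      = (\<Sum>j\<in>S. A k j * cmod (w j)) - Re (cnj \<omega> * (\<Sum>j\<in>S. of_real (A k j) * w j))"
    by (simp add: right_diff_distrib sum_subtractf sum_distrib_left Re_sum sum_distrib_left algebra_simps)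
  also have "\<dots> = 0"
    unfolding row using \<omega>' by (simp add: mult.assoc[symmetric] mult.commute[of "cnj \<omega>"])
  finally have sum0: "(\<Sum>j\<in>S. A k j * (cmod (w j) - Re (cnj \<omega> * w j))) = 0" .
  have "Re (cnj \<omega> * w j) \<le> cmod (w j)" for j
    using complex_Re_le_cmod[of "cnj \<omega> * w j"] \<omega> by (simp only: norm_mult complex_mod_cnj mult_1)
  then have "A k k * (cmod (w k) - Re (cnj \<omega> * w k)) = 0"
    using sum0 fin k pos
    by (subst (asm) sum_nonneg_eq_0_iff) (simp_all only: mult_nonneg_nonneg less_imp_le diff_ge_0_iff_ge)
  then have "Re (cnj \<omega> * w k) = cmod (w k)"
    using pos[OF k(1) k(1)] by simp
  moreover have "cmod (cnj \<omega> * w k) = cmod (w k)"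
    using \<omega> by (simp only: norm_mult complex_mod_cnj mult_1)
  ultimately have "cnj \<omega> * w k = of_real (cmod (w k))"
    using cmod_power2[of "cnj \<omega> * w k"] by (simp only: complex_eq_iff) simp
  then have "w k = \<omega> * of_real (cmod (w k))"
    using \<omega>' by (metis mult.assoc mult.left_commute mult.right_neutral)
  then show ?thesis
    using False k by (simp add: \<omega>_def norm_mult field_simps)
qed simp


section \<open>The chain identity for one column\<close>

definition sg :: "bool \<Rightarrow> complex" where
  "sg s = (if s then - 1 else 1)"

primrec parity_before :: "(nat \<Rightarrow> bool) \<Rightarrow> nat \<Rightarrow> bool" where
  "parity_before b 0 = False"
| "parity_before b (Suc i) = (parity_before b i \<noteq> b i)"

definition chain_weight :: "nat \<Rightarrow> (nat \<Rightarrow> 'a) \<Rightarrow> (nat \<Rightarrow> bool) \<Rightarrow> 'a::comm_semiring_1" where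
  "chain_weight k w b = (\<Prod>j<k. if parity_before b (Suc j) then w j else 1)"

definition chain_sign :: "(nat \<Rightarrow> bool) \<Rightarrow> nat \<Rightarrow> complex" where
  "chain_sign b i = (\<Prod>k\<le>i. sg (parity_before b (Suc k)))"

lemma sg_simps [simp]: "sg True = - 1" "sg False = 1" "sg (\<not> s) = - sg s" "sg s * sg s = 1"
  by (cases s; simp add: sg_def)+

lemma sg_xor: "sg (s \<noteq> t) = sg s * sg t"
  by (cases s; cases t; simp)

lemma sg_eq_iff: "sg s = sg t \<longleftrightarrow> s = t"
  by (cases s; cases t; simp)

lemma parity_before_flip:
  "parity_before (b(k := \<not> b k)) j = (parity_before b j \<noteq> (k < j))"
  by (induction j) (auto simp: less_Suc_eq)

text \<open>
  At site \<open>i\<close> of the chain, \<open>p i\<close> and \<open>q i\<close> are the values of the kernel vector at the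
  triangle vertices facing the previous and the next site, \<open>u i\<close> is the value at the vertex of
  the \<open>b\<close>-edge and \<open>d i\<close> the weighted value at the other end of that edge. The missing edge after
  the last site is given weight 0, which also encodes the parity constraint.
\<close>

lemma chain_telescope:
  fixes w p q u d :: "nat \<Rightarrow> complex"
  assumes q0: "q 0 = u 0"
    and qS: "\<And>i. Suc i < L \<Longrightarrow> q (Suc i) = u (Suc i) + w i * q i"
    and u: "\<And>i. i < L \<Longrightarrow> u i = p i + w i * p (Suc i)"
    and d: "\<And>i. i < L \<Longrightarrow> d i = p i - q i"
  shows "i < L \<Longrightarrow>
    (\<Sum>k\<le>i. chain_sign b k * (if b k then - d k else u k) * chain_weight (Suc i) w (b(k := \<not> b k)))
    = chain_sign b i * w i * (if parity_before b (Suc i) then p (Suc i) else q i) * chain_weight i w b"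
proof (induction i)
  case 0
  then show ?case
    using q0 u[of 0] d[of 0]
    by (cases "b 0") (auto simp: chain_sign_def chain_weight_def algebra_simps)
next
  case (Suc i)
  define e where "e k = parity_before b (Suc k)" for k
  have e_Suc: "e (Suc k) = (e k \<noteq> b (Suc k))" for k
    by (simp add: e_def)
  have sgn: "chain_sign b (Suc i) = chain_sign b i * sg (e (Suc i))"
    by (simp add: chain_sign_def e_def)
  let ?c = "\<lambda>k. if b k then - d k else u k"
  let ?t = "if e (Suc i) then 1 else w (Suc i)"
  have wt: "chain_weight (Suc (Suc i)) w (b(k := \<not> b k))
      = chain_weight (Suc i) w (b(k := \<not> b k)) * ?t" if "k \<le> i" for k
    using that by (simp add: chain_weight_def parity_before_flip e_def del: parity_before.simps)
  have wt': "chain_weight (Suc (Suc i)) w (b(Suc i := \<not> b (Suc i))) = chain_weight (Suc i) w b * ?t"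
    by (simp add: chain_weight_def parity_before_flip e_def del: parity_before.simps)
  have W: "chain_weight (Suc i) w b = chain_weight i w b * (if e i then w i else 1)"
    by (simp add: chain_weight_def e_def)
  let ?S = "\<Sum>k\<le>i. chain_sign b k * ?c k * chain_weight (Suc i) w (b(k := \<not> b k))"
  have "(\<Sum>k\<le>Suc i. chain_sign b k * ?c k * chain_weight (Suc (Suc i)) w (b(k := \<not> b k)))
      = (?S + chain_sign b (Suc i) * ?c (Suc i) * chain_weight (Suc i) w b) * ?t"
    by (simp add: wt wt' sum_distrib_right distrib_right mult.assoc)
  also have "?S = chain_sign b i * w i * (if e i then p (Suc i) else q i) * chain_weight i w b"
    using Suc.IH[OF Suc_lessD[OF Suc.prems]] unfolding e_def .
  also have "(chain_sign b i * w i * (if e i then p (Suc i) else q i) * chain_weight i w b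
        + chain_sign b (Suc i) * ?c (Suc i) * chain_weight (Suc i) w b) * ?t
      = chain_sign b (Suc i) * w (Suc i) * (if e (Suc i) then p (Suc (Suc i)) else q (Suc i))
        * chain_weight (Suc i) w b"
  proof -
    have u': "u (Suc i) = p (Suc i) + w (Suc i) * p (Suc (Suc i))"
      using u[OF Suc.prems] .
    have q': "q (Suc i) = p (Suc i) + w (Suc i) * p (Suc (Suc i)) + w i * q i"
      using qS[OF Suc.prems] u' by simp
    have d': "d (Suc i) = - (w (Suc i) * p (Suc (Suc i))) - w i * q i"
      using d[OF Suc.prems] q' by simp
    show ?thesis
      unfolding W sgn u' q' d' using e_Suc[of i]
      by (cases "e i"; cases "b (Suc i)") (simp_all add: algebra_simps)
  qed
  finally show ?case
    unfolding e_def .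
qed

lemma chain_identity:
  fixes w p q u d :: "nat \<Rightarrow> complex"
  assumes "q 0 = u 0"
    and "\<And>i. Suc i < L \<Longrightarrow> q (Suc i) = u (Suc i) + w i * q i"
    and "\<And>i. i < L \<Longrightarrow> u i = p i + w i * p (Suc i)"
    and "\<And>i. i < L \<Longrightarrow> d i = p i - q i"
    and "L > 0" and "w (L - 1) = 0"
  shows "(\<Sum>k<L. chain_sign b k * (if b k then - d k else u k) * chain_weight L w (b(k := \<not> b k))) = 0"
proof -
  obtain l where l: "L = Suc l" using \<open>L > 0\<close> by (cases L) auto
  show ?thesis
    using chain_telescope[of q u L w p d l b] assms by (simp add: l lessThan_Suc_atMost)
qed

text \<open>
  The sites of a column form a chain of length \<open>2 * m\<close>, with $\omega(x,y)$ at place \<open>2 * y\<close> and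
  $\beta(x,y)$ at place \<open>2 * y + 1\<close>; the sets \<open>N\<close> and \<open>N'\<close> describe the cuts to the left and to
  the right of the column.
\<close>

definition flip :: "nat \<Rightarrow> nat set \<Rightarrow> nat set" where
  "flip y N = {k. (k \<in> N) \<noteq> (k = y)}"

definition string_sign :: "nat set \<Rightarrow> nat \<Rightarrow> complex" where
  "string_sign N y = (\<Prod>k<y. sg (k \<in> N))"

definition interleave :: "nat set \<Rightarrow> nat set \<Rightarrow> nat \<Rightarrow> bool" where
  "interleave N N' i = (i div 2 \<in> (if even i then N else N'))"

lemma in_flip [simp]: "k \<in> flip y N \<longleftrightarrow> (k \<in> N) \<noteq> (k = y)"
  by (simp add: flip_def)

lemma flip_flip [simp]: "flip y (flip y N) = N"
  by auto

lemma flip_commute: "flip y (flip k N) = flip k (flip y N)"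
  by auto

lemma flip_subset [simp]: "y < m \<Longrightarrow> flip y N \<subseteq> {..<m} \<longleftrightarrow> N \<subseteq> {..<m}"
  by (auto simp: subset_iff)

lemma string_sign_Suc: "string_sign N (Suc y) = string_sign N y * sg (y \<in> N)"
  by (simp add: string_sign_def)

lemma string_sign_square [simp]: "string_sign N y * string_sign N y = 1"
  by (simp add: string_sign_def prod.distrib[symmetric])

lemma string_sign_flip:
  "string_sign (flip y N) k = (if y < k then - string_sign N k else string_sign N k)"
  by (induction k) (auto simp: string_sign_Suc less_Suc_eq, auto simp: string_sign_def)

lemma string_sign_cases: "string_sign N y = 1 \<or> string_sign N y = - 1"
  by (induction y) (auto simp: string_sign_Suc sg_def, auto simp: string_sign_def)

lemma interleave_simps [simp]:
  "interleave N N' (2 * y) = (y \<in> N)" "interleave N N' (Suc (2 * y)) = (y \<in> N')"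
  by (simp_all add: interleave_def)

lemma sg_parity_before_Suc:
  "sg (parity_before b (Suc i)) = sg (parity_before b i) * sg (b i)"
  by (simp only: parity_before.simps sg_xor)

lemma sg_parity_interleave:
  "sg (parity_before (interleave N N') (2 * y)) = string_sign N y * string_sign N' y"
  "sg (parity_before (interleave N N') (Suc (2 * y))) = string_sign N (Suc y) * string_sign N' y"
proof (induction y)
  case 0
  case 1 show ?case by (simp add: string_sign_def)
  case 2 show ?case
    using interleave_simps(1)[of N N' 0] by (simp add: string_sign_def sg_parity_before_Suc)
next
  case (Suc y)
  have *: "sg (parity_before (interleave N N') (2 * Suc y)) = string_sign N (Suc y) * string_sign N' (Suc y)"
    unfolding mult_Suc_right add_2_eq_Suc sg_parity_before_Suc[of _ "Suc _"] interleave_simps Suc(2)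
    by (simp only: string_sign_Suc mult_ac)
  case 1 show ?case by (rule *)
  case 2 show ?case
    unfolding sg_parity_before_Suc interleave_simps * by (simp only: string_sign_Suc mult_ac)
qed

lemma chain_sign_Suc: "chain_sign b (Suc i) = chain_sign b i * sg (parity_before b (Suc (Suc i)))"
  by (simp add: chain_sign_def)

lemma chain_sign_interleave:
  "chain_sign (interleave N N') (2 * y) = string_sign N (Suc y)"
  "chain_sign (interleave N N') (Suc (2 * y)) = string_sign N' (Suc y)"
proof (induction y)
  case 0
  have p0: "sg (parity_before (interleave N N') (Suc 0)) = sg (0 \<in> N)"
    using sg_parity_interleave(2)[of N N' 0] by (simp add: string_sign_def)
  then have base: "chain_sign (interleave N N') 0 = string_sign N (Suc 0)"
    by (simp add: chain_sign_def string_sign_def del: parity_before.simps)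
  have p1: "sg (parity_before (interleave N N') (Suc (Suc 0))) = sg (0 \<in> N) * sg (0 \<in> N')"
    using sg_parity_interleave(1)[of N N' 1] by (simp add: string_sign_def numeral_2_eq_2)
  case 1 show ?case using base by simp
  case 2 show ?case
    using base p1 by (simp add: chain_sign_Suc string_sign_def mult.assoc[symmetric] del: parity_before.simps)
next
  case (Suc y)
  have *: "chain_sign (interleave N N') (2 * Suc y) = string_sign N (Suc (Suc y))"
    using Suc(2) sg_parity_interleave(2)[of N N' "Suc y"] 
    by (simp add: chain_sign_Suc mult_ac del: parity_before.simps)
  case 1 show ?case by (rule *)
  case 2 show ?case
    using * sg_parity_interleave(1)[of N N' "Suc (Suc y)"] 
    by (simp add: chain_sign_Suc mult_ac del: parity_before.simps)
qed

lemma interleave_flip: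
  "(interleave N N')(2 * y := \<not> interleave N N' (2 * y)) = interleave (flip y N) N'"
  "(interleave N N')(Suc (2 * y) := \<not> interleave N N' (Suc (2 * y))) = interleave N (flip y N')"
  by (auto simp: interleave_def fun_eq_iff elim!: evenE oddE)

lemma sum_lessThan_double: "(\<Sum>k<2 * m. f k) = (\<Sum>y<m. f (2 * y) + f (Suc (2 * y)))"
  for f :: "nat \<Rightarrow> 'a::comm_monoid_add"
  by (induction m) (simp_all add: add_ac)

definition column_matrix :: "nat \<Rightarrow> (nat \<Rightarrow> real) \<Rightarrow> nat set \<Rightarrow> nat set \<Rightarrow> real" where
  "column_matrix m w N' N = chain_weight (2 * m) w (interleave N N')"

lemma of_real_chain_weight:
  "of_real (chain_weight k w b) = chain_weight k (\<lambda>j. of_real (w j)) b"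
  by (simp add: chain_weight_def if_distrib cong: if_cong)

lemma column_identity:
  fixes p q u d :: "nat \<Rightarrow> complex" and w :: "nat \<Rightarrow> real"
  assumes "q 0 = u 0"
    and "\<And>i. Suc i < 2 * m \<Longrightarrow> q (Suc i) = u (Suc i) + of_real (w i) * q i"
    and "\<And>i. i < 2 * m \<Longrightarrow> u i = p i + of_real (w i) * p (Suc i)"
    and "\<And>i. i < 2 * m \<Longrightarrow> d i = p i - q i"
    and "m > 0" and "w (2 * m - 1) = 0"
  shows "(\<Sum>y<m. string_sign N y * (if y \<in> N then d (2 * y) else u (2 * y))
             * of_real (column_matrix m w N' (flip y N)))
       = - (\<Sum>y<m. string_sign N' y * (if y \<in> N' then d (Suc (2 * y)) else u (Suc (2 * y)))
             * of_real (column_matrix m w (flip y N') N))"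
proof -
  let ?W = "\<lambda>b. chain_weight (2 * m) (\<lambda>j. complex_of_real (w j)) b"
  have even: "chain_sign (interleave N N') (2 * y)
        * (if interleave N N' (2 * y) then - d (2 * y) else u (2 * y))
      = string_sign N y * (if y \<in> N then d (2 * y) else u (2 * y))" for y
    unfolding chain_sign_interleave by (simp add: string_sign_Suc interleave_def)
  have odd: "chain_sign (interleave N N') (Suc (2 * y))
        * (if interleave N N' (Suc (2 * y)) then - d (Suc (2 * y)) else u (Suc (2 * y)))
      = string_sign N' y * (if y \<in> N' then d (Suc (2 * y)) else u (Suc (2 * y)))" for y
    unfolding chain_sign_interleave by (simp add: string_sign_Suc interleave_def)
  have "(\<Sum>k<2 * m. chain_sign (interleave N N') k
          * (if interleave N N' k then - d k else u k)
          * ?W ((interleave N N')(k := \<not> interleave N N' k))) = 0"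
    using assms by (intro chain_identity[where p = p and q = q]) simp_all
  then show ?thesis
    unfolding sum_lessThan_double interleave_flip even odd sum.distrib
    by (simp add: column_matrix_def of_real_chain_weight eq_neg_iff_add_eq_0)
qed

lemma column_matrix_pos:
  assumes m: "m > 0" and w: "w (2 * m - 1) = 0" "\<And>i. i < 2 * m - 1 \<Longrightarrow> w i > 0"
    and eq: "string_sign N m = string_sign N' m"
  shows "column_matrix m w N' N > 0"
proof -
  have "sg (parity_before (interleave N N') (2 * m)) = 1"
    by (simp add: sg_parity_interleave eq)
  then have last: "\<not> parity_before (interleave N N') (2 * m)"
    by (metis sg_eq_iff sg_simps(2))
  have "(if parity_before (interleave N N') (Suc j) then w j else 1) > 0" if "j < 2 * m" for j
  proof (cases "j = 2 * m - 1")
    case True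
    then show ?thesis using last m by simp
  qed (use w that in \<open>auto simp del: parity_before.simps\<close>)
  then show ?thesis
    unfolding column_matrix_def chain_weight_def by (intro prod_pos) auto
qed

lemma column_matrix_zero:
  assumes m: "m > 0" and w: "w (2 * m - 1) = 0"
    and neq: "string_sign N m \<noteq> string_sign N' m"
  shows "column_matrix m w N' N = 0"
proof -
  have "sg (parity_before (interleave N N') (2 * m)) = - 1"
    using neq string_sign_cases[of N m] string_sign_cases[of N' m]
    by (auto simp: sg_parity_interleave)
  then have "parity_before (interleave N N') (2 * m)"
    by (metis sg_eq_iff sg_simps(1))
  then show ?thesis
    unfolding column_matrix_def chain_weight_def using m w
    by (intro prod_zero bexI[of _ "2 * m - 1"]) (simp_all del: parity_before.simps)
qed


section \<open>Fermions on the cut\<close>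

text \<open>
  States are sets \<open>N \<subseteq> {..<m}\<close> of \<open>b\<close>-edges of a cut, namely those not covered by dimers.
  The coefficients of creation and of annihilation at \<open>y\<close> are \<open>h y True\<close> and \<open>h y False\<close>, and
  \<open>string_sign\<close> is the Jordan--Wigner sign.
\<close>

definition fermion :: "nat \<Rightarrow> (nat \<Rightarrow> bool \<Rightarrow> complex) \<Rightarrow> (nat set \<Rightarrow> complex) \<Rightarrow> nat set \<Rightarrow> complex" where
  "fermion m h \<Phi> M = (\<Sum>y<m. string_sign M y * h y (y \<in> M) * \<Phi> (flip y M))"

definition adj :: "(nat \<Rightarrow> bool \<Rightarrow> complex) \<Rightarrow> nat \<Rightarrow> bool \<Rightarrow> complex" where
  "adj h y s = h y (\<not> s)"

text \<open>
  The operator identity \<open>V \<circ> fermion m h = fermion m h' \<circ> V\<close>, written for matrix entries.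
\<close>

definition intertwines ::
  "nat \<Rightarrow> (nat set \<Rightarrow> nat set \<Rightarrow> real) \<Rightarrow> (nat \<Rightarrow> bool \<Rightarrow> complex) \<Rightarrow> (nat \<Rightarrow> bool \<Rightarrow> complex) \<Rightarrow> bool" where
  "intertwines m V h h' \<longleftrightarrow> (\<forall>N' \<in> Pow {..<m}. \<forall>N \<in> Pow {..<m}.
     fermion m (adj h) (\<lambda>N. of_real (V N' N)) N = fermion m h' (\<lambda>M. of_real (V M N)) N')"

lemma fermion_cong:
  assumes "M \<subseteq> {..<m}" "\<And>N. N \<subseteq> {..<m} \<Longrightarrow> \<Phi> N = \<Phi>' N"
  shows "fermion m h \<Phi> M = fermion m h \<Phi>' M"
  using assms by (simp add: fermion_def)

lemma fermion_sum:
  "fermion m h (\<lambda>N. \<Sum>i\<in>I. c i * \<Phi> i N) M = (\<Sum>i\<in>I. c i * fermion m h (\<Phi> i) M)"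
  unfolding fermion_def
  by (simp add: sum_distrib_left mult_ac) (rule sum.swap)

lemma fermion_sum':
  "fermion m h (\<lambda>N. \<Sum>i\<in>I. \<Phi> i N * c i) M = (\<Sum>i\<in>I. fermion m h (\<Phi> i) M * c i)"
  using fermion_sum[where c = c and \<Phi> = \<Phi>] by (simp add: mult.commute)

lemma fermion_scale: "fermion m h (\<lambda>N. c * \<Phi> N) M = c * fermion m h \<Phi> M"
  by (simp add: fermion_def sum_distrib_left mult_ac)

lemma fermion_scale_coeff: "fermion m (\<lambda>y s. c * h y s) \<Phi> M = c * fermion m h \<Phi> M"
  by (simp add: fermion_def sum_distrib_left mult_ac)

lemma fermion_adjoint:
  "(\<Sum>M\<in>Pow {..<m}. \<Phi>' M * fermion m h \<Phi> M) = (\<Sum>M\<in>Pow {..<m}. fermion m (adj h) \<Phi>' M * \<Phi> M)"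
proof -
  have "(\<Sum>M\<in>Pow {..<m}. \<Phi>' M * (string_sign M y * h y (y \<in> M) * \<Phi> (flip y M)))
      = (\<Sum>M\<in>Pow {..<m}. string_sign M y * adj h y (y \<in> M) * \<Phi>' (flip y M) * \<Phi> M)"
    if y: "y < m" for y
    by (rule sum.reindex_bij_witness[of _ "flip y" "flip y"])
       (use y in \<open>auto simp: string_sign_flip adj_def mult_ac\<close>)
  then show ?thesis
    unfolding fermion_def sum_distrib_left sum_distrib_right
    by (subst (1 2) sum.swap) simp
qed

lemma fermion_anticommute:
  "fermion m h (fermion m h' \<Phi>) M + fermion m h' (fermion m h \<Phi>) M
    = (\<Sum>y<m. h y True * h' y False + h' y True * h y False) * \<Phi> M"
proof -
  define T where "T h h' y k = string_sign M y * h y (y \<in> M) *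
      (string_sign (flip y M) k * h' k (k \<in> flip y M) * \<Phi> (flip k (flip y M)))"
    for h h' :: "nat \<Rightarrow> bool \<Rightarrow> complex" and y k
  have T: "T h h' y k + T h' h k y = (if y = k then (h y True * h' y False + h' y True * h y False) * \<Phi> M else 0)"
    for y k
  proof (cases "y = k")
    case True
    have s: "string_sign M k * (string_sign M k * x) = x" for x
      by (simp add: mult.assoc[symmetric])
    show ?thesis
      using True by (cases "k \<in> M") (simp_all add: T_def string_sign_flip mult_ac s distrib_left)
  next
    case False
    then show ?thesis
      by (cases "y < k") (simp_all add: T_def string_sign_flip flip_commute[of y k] mult_ac)
  qed
  have "fermion m h (fermion m h' \<Phi>) M + fermion m h' (fermion m h \<Phi>) M
      = (\<Sum>y<m. \<Sum>k<m. T h h' y k) + (\<Sum>k<m. \<Sum>y<m. T h' h k y)"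
    by (simp add: fermion_def T_def sum_distrib_left)
  also have "(\<Sum>k<m. \<Sum>y<m. T h' h k y) = (\<Sum>y<m. \<Sum>k<m. T h' h k y)"
    by (rule sum.swap)
  finally show ?thesis
    by (simp add: sum.distrib[symmetric] T sum_distrib_right)
qed

definition mat_comp :: "nat \<Rightarrow> (nat set \<Rightarrow> nat set \<Rightarrow> real) \<Rightarrow> (nat set \<Rightarrow> nat set \<Rightarrow> real) \<Rightarrow> nat set \<Rightarrow> nat set \<Rightarrow> real" where
  "mat_comp m V U M N = (\<Sum>K\<in>Pow {..<m}. V M K * U K N)"

lemma intertwines_comp:
  assumes U: "intertwines m U h h'" and V: "intertwines m V h' h''"
  shows "intertwines m (mat_comp m V U) h h''"
  unfolding intertwines_def
proof (intro ballI)
  fix M N assume M: "M \<in> Pow {..<m}" and N: "N \<in> Pow {..<m}"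
  let ?V = "\<lambda>M K. complex_of_real (V M K)" and ?U = "\<lambda>K N. complex_of_real (U K N)"
  have "fermion m (adj h) (\<lambda>N. of_real (mat_comp m V U M N)) N
      = (\<Sum>K\<in>Pow {..<m}. ?V M K * fermion m (adj h) (?U K) N)"
    by (simp add: mat_comp_def fermion_sum)
  also have "\<dots> = (\<Sum>K\<in>Pow {..<m}. ?V M K * fermion m h' (\<lambda>L. ?U L N) K)"
    using U N by (intro sum.cong) (auto simp: intertwines_def)
  also have "\<dots> = (\<Sum>K\<in>Pow {..<m}. fermion m (adj h') (?V M) K * ?U K N)"
    by (rule fermion_adjoint)
  also have "\<dots> = (\<Sum>K\<in>Pow {..<m}. fermion m h'' (\<lambda>L. ?V L K) M * ?U K N)"
    using V M by (intro sum.cong) (auto simp: intertwines_def)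
  also have "\<dots> = fermion m h'' (\<lambda>L. of_real (mat_comp m V U L N)) M"
    by (simp add: mat_comp_def fermion_sum')
  finally show "fermion m (adj h) (\<lambda>N. of_real (mat_comp m V U M N)) N
      = fermion m h'' (\<lambda>L. of_real (mat_comp m V U L N)) M" .
qed

definition sector :: "nat \<Rightarrow> complex \<Rightarrow> nat set set" where
  "sector m c = {N. N \<subseteq> {..<m} \<and> string_sign N m = c}"

definition sector_positive :: "nat \<Rightarrow> (nat set \<Rightarrow> nat set \<Rightarrow> real) \<Rightarrow> bool" where
  "sector_positive m V \<longleftrightarrow> (\<forall>M \<in> Pow {..<m}. \<forall>N \<in> Pow {..<m}.
     if string_sign M m = string_sign N m then V M N > 0 else V M N = 0)"

lemma sector_positiveD:
  assumes "sector_positive m V" "M \<subseteq> {..<m}" "N \<subseteq> {..<m}"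
  shows "string_sign M m = string_sign N m \<Longrightarrow> V M N > 0"
    and "string_sign M m \<noteq> string_sign N m \<Longrightarrow> V M N = 0"
  using assms unfolding sector_positive_def by (metis Pow_iff)+

lemma finite_sector [simp]: "finite (sector m c)"
  unfolding sector_def by (rule finite_subset[of _ "Pow {..<m}"]) auto

lemma sector_nonempty:
  assumes "m > 0" "c = 1 \<or> c = - 1"
  shows "sector m c \<noteq> {}"
proof -
  have e: "string_sign {} m = 1"
    by (simp add: string_sign_def)
  then have "string_sign (flip 0 {}) m = - 1"
    using assms by (simp add: string_sign_flip)
  then have "{} \<in> sector m 1" "flip 0 {} \<in> sector m (- 1)"
    using e assms by (auto simp: sector_def)
  then show ?thesis using assms by blast
qed

lemma sector_positive_comp:
  assumes V: "sector_positive m V" and U: "sector_positive m U"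
  shows "sector_positive m (mat_comp m V U)"
  unfolding sector_positive_def
proof (intro ballI)
  fix M N assume M: "M \<in> Pow {..<m}" and N: "N \<in> Pow {..<m}"
  have V': "if string_sign M m = string_sign K m then V M K > 0 else V M K = 0" if "K \<in> Pow {..<m}" for K
    using V M that unfolding sector_positive_def by blast
  have U': "if string_sign K m = string_sign N m then U K N > 0 else U K N = 0" if "K \<in> Pow {..<m}" for K
    using U N that unfolding sector_positive_def by blast
  have nonneg: "V M K * U K N \<ge> 0" if "K \<in> Pow {..<m}" for K
    using V'[OF that] U'[OF that] by (auto split: if_splits intro!: mult_nonneg_nonneg)
  show "if string_sign M m = string_sign N m then mat_comp m V U M N > 0 else mat_comp m V U M N = 0"
  proof (cases "string_sign M m = string_sign N m")
    case True
    have "mat_comp m V U M N > 0"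
      unfolding mat_comp_def
      by (rule sum_pos2[OF _ M]) (use V'[OF M] U'[OF M] True nonneg in auto)
    with True show ?thesis by simp
  next
    case False
    have "V M K * U K N = 0" if "K \<in> Pow {..<m}" for K
      using V'[OF that] U'[OF that] False by (auto split: if_splits)
    then have "mat_comp m V U M N = 0"
      unfolding mat_comp_def by (intro sum.neutral) blast
    with False show ?thesis by simp
  qed
qed

lemma sum_sector:
  fixes f :: "nat set \<Rightarrow> 'a::comm_monoid_add"
  assumes "\<And>N. N \<subseteq> {..<m} \<Longrightarrow> string_sign N m \<noteq> c \<Longrightarrow> f N = 0"
  shows "sum f (Pow {..<m}) = sum f (sector m c)"
  using assms by (intro sum.mono_neutral_right) (auto simp: sector_def)

lemma fermion_sector:
  assumes "\<And>N. N \<subseteq> {..<m} \<Longrightarrow> string_sign N m \<noteq> c \<Longrightarrow> \<Phi> N = 0"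
    and "M \<subseteq> {..<m}" "string_sign M m \<noteq> - c"
  shows "fermion m h \<Phi> M = 0"
  unfolding fermion_def
proof (intro sum.neutral ballI)
  fix y assume "y \<in> {..<m}"
  then have "\<Phi> (flip y M) = 0"
    using assms by (intro assms(1)) (auto simp: string_sign_flip)
  then show "string_sign M y * h y (y \<in> M) * \<Phi> (flip y M) = 0"
    by simp
qed

definition sector_perron ::
  "nat \<Rightarrow> (nat set \<Rightarrow> nat set \<Rightarrow> real) \<Rightarrow> complex \<Rightarrow> real \<Rightarrow> (nat set \<Rightarrow> real) \<Rightarrow> bool" where
  "sector_perron m V c r \<phi> \<longleftrightarrow> r > 0
     \<and> (\<forall>N. N \<subseteq> {..<m} \<longrightarrow> (string_sign N m = c \<longrightarrow> \<phi> N > 0) \<and> (string_sign N m \<noteq> c \<longrightarrow> \<phi> N = 0))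
     \<and> (\<forall>M. M \<subseteq> {..<m} \<longrightarrow> (\<Sum>N\<in>Pow {..<m}. V M N * \<phi> N) = r * \<phi> M)"

lemma sector_perronD:
  assumes "sector_perron m V c r \<phi>"
  shows "r > 0"
    and "N \<subseteq> {..<m} \<Longrightarrow> string_sign N m = c \<Longrightarrow> \<phi> N > 0"
    and "N \<subseteq> {..<m} \<Longrightarrow> string_sign N m \<noteq> c \<Longrightarrow> \<phi> N = 0"
    and "N \<subseteq> {..<m} \<Longrightarrow> (\<Sum>K\<in>Pow {..<m}. V N K * \<phi> K) = r * \<phi> N"
  using assms unfolding sector_perron_def by blast+

lemma sector_positive_transpose:
  assumes "sector_positive m V"
  shows "sector_positive m (\<lambda>M N. V N M)"
  unfolding sector_positive_def
proof (intro ballI)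
  fix M N
  assume "M \<in> Pow {..<m}" "N \<in> Pow {..<m}"
  then show "if string_sign M m = string_sign N m then V N M > 0 else V N M = 0"
    using sector_positiveD[OF assms, of N M] by (cases "string_sign M m = string_sign N m") auto
qed

lemma sector_perron_exists:
  assumes V: "sector_positive m V" and m: "m > 0" and c: "c = 1 \<or> c = - 1"
  obtains r \<phi> where "sector_perron m V c r \<phi>"
proof -
  have Vp: "V M N > 0" if "M \<in> sector m c" "N \<in> sector m c" for M N
    using sector_positiveD(1)[OF V] that by (simp add: sector_def)
  obtain r \<phi> where r: "r > 0" and pos: "\<And>N. N \<in> sector m c \<Longrightarrow> \<phi> N > 0"
    and eig: "\<And>M. M \<in> sector m c \<Longrightarrow> (\<Sum>N\<in>sector m c. V M N * \<phi> N) = r * \<phi> M"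
    using perron_eigenvector[of "sector m c" V, OF finite_sector sector_nonempty[OF m c] Vp] by metis
  define \<phi>' where "\<phi>' N = (if N \<in> sector m c then \<phi> N else 0)" for N
  have "(\<Sum>N\<in>Pow {..<m}. V M N * \<phi>' N) = r * \<phi>' M" if M: "M \<subseteq> {..<m}" for M
  proof -
    have "(\<Sum>N\<in>Pow {..<m}. V M N * \<phi>' N) = (\<Sum>N\<in>sector m c. V M N * \<phi>' N)"
      by (rule sum_sector) (simp add: \<phi>'_def sector_def)
    also have "\<dots> = (\<Sum>N\<in>sector m c. V M N * \<phi> N)"
      by (simp add: \<phi>'_def)
    also have "\<dots> = r * \<phi>' M"
    proof (cases "M \<in> sector m c")
      case False
      then have "V M N = 0" if "N \<in> sector m c" for N
        using sector_positiveD(2)[OF V M] M that by (auto simp: sector_def)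
      then show ?thesis using False by (simp add: \<phi>'_def)
    qed (simp add: eig \<phi>'_def)
    finally show ?thesis .
  qed
  then have "sector_perron m V c r \<phi>'"
    unfolding sector_perron_def using r pos by (auto simp: \<phi>'_def sector_def)
  then show ?thesis using that by blast
qed

lemma sector_perron_transpose_eq:
  assumes m: "m > 0" and c: "c = 1 \<or> c = - 1"
    and R: "sector_perron m V c r \<phi>" and L: "sector_perron m (\<lambda>M N. V N M) c r' \<psi>"
  shows "(\<Sum>M\<in>Pow {..<m}. \<psi> M * \<phi> M) > 0" and "r' = r"
proof -
  have nn: "\<psi> M * \<phi> M \<ge> 0" if "M \<in> Pow {..<m}" for M
    using sector_perronD(2,3)[OF R, of M] sector_perronD(2,3)[OF L, of M] that
    by (cases "string_sign M m = c") (simp_all add: less_imp_le)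
  obtain M where M: "M \<in> sector m c"
    using sector_nonempty[OF m c] by blast
  show pos: "(\<Sum>M\<in>Pow {..<m}. \<psi> M * \<phi> M) > 0"
    by (rule sum_pos2[of _ M]) (use sector_perronD(2)[OF R, of M] sector_perronD(2)[OF L, of M] M nn in
        \<open>auto simp: sector_def\<close>)
  have "r * (\<Sum>M\<in>Pow {..<m}. \<psi> M * \<phi> M) = (\<Sum>M\<in>Pow {..<m}. \<psi> M * (\<Sum>N\<in>Pow {..<m}. V M N * \<phi> N))"
    unfolding sum_distrib_left[of r]
    by (intro sum.cong refl) (use sector_perronD(4)[OF R] in simp)
  also have "\<dots> = (\<Sum>N\<in>Pow {..<m}. (\<Sum>M\<in>Pow {..<m}. V M N * \<psi> M) * \<phi> N)"
    unfolding sum_distrib_left sum_distrib_right by (subst sum.swap) (simp add: mult_ac)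
  also have "\<dots> = r' * (\<Sum>M\<in>Pow {..<m}. \<psi> M * \<phi> M)"
    unfolding sum_distrib_left[of r']
    by (intro sum.cong refl) (use sector_perronD(4)[OF L] in simp)
  finally show "r' = r" using pos by simp
qed

text \<open>
  A fermion maps the Perron vector of one sector to an eigenvector in the other sector. If the
  other Perron value is not larger, this eigenvector is peripheral, hence zero unless its
  eigenvalue is positive.
\<close>

lemma fermion_kills_perron:
  assumes V: "sector_positive m V" and m: "m > 0" and c: "c = 1 \<or> c = - 1"
    and R: "sector_perron m V c r \<phi>" and L: "sector_perron m (\<lambda>M N. V N M) (- c) r' \<psi>"
    and le: "r' \<le> r" and \<zeta>: "cmod \<zeta> = 1" "\<zeta> \<noteq> 1"
    and eig: "\<And>M. M \<subseteq> {..<m} \<Longrightarrow>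
      (\<Sum>N\<in>Pow {..<m}. of_real (V M N) * fermion m h (\<lambda>N. of_real (\<phi> N)) N)
        = \<zeta> * of_real r * fermion m h (\<lambda>N. of_real (\<phi> N)) M"
    and M: "M \<subseteq> {..<m}"
  shows "fermion m h (\<lambda>N. of_real (\<phi> N)) M = 0"
proof (rule ccontr)
  define w where "w = fermion m h (\<lambda>N. of_real (\<phi> N))"
  assume "\<not> ?thesis"
  then have nz: "w M \<noteq> 0" by (simp add: w_def)
  have r: "r > 0" using R by (rule sector_perronD)
  have w0: "w N = 0" if "N \<subseteq> {..<m}" "string_sign N m \<noteq> - c" for N
    unfolding w_def
    by (rule fermion_sector[OF _ that]) (simp add: sector_perronD(3)[OF R])
  then have "M \<in> sector m (- c)"
    using nz M by (auto simp: sector_def)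
  moreover have "V M N > 0" if "M \<in> sector m (- c)" "N \<in> sector m (- c)" for M N
    using sector_positiveD(1)[OF V] that by (simp add: sector_def)
  moreover have "(\<Sum>M\<in>sector m (- c). \<psi> M * V M N) = r' * \<psi> N" if "N \<in> sector m (- c)" for N
  proof -
    have "(\<Sum>M\<in>Pow {..<m}. \<psi> M * V M N) = (\<Sum>M\<in>sector m (- c). \<psi> M * V M N)"
      by (rule sum_sector) (simp add: sector_perronD(3)[OF L])
    then show ?thesis
      using sector_perronD(4)[OF L, of N] that by (simp add: sector_def mult.commute)
  qed
  moreover have "(\<Sum>N\<in>sector m (- c). of_real (V M N) * w N) = \<zeta> * of_real r * w M"
    if "M \<in> sector m (- c)" for M
  proof -
    have "(\<Sum>N\<in>Pow {..<m}. of_real (V M N) * w N) = (\<Sum>N\<in>sector m (- c). of_real (V M N) * w N)"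
      by (rule sum_sector) (use w0 in auto)
    then show ?thesis
      using eig[of M] that by (auto simp: w_def sector_def)
  qed
  moreover have "\<psi> N > 0" if "N \<in> sector m (- c)" for N
    using sector_perronD(2)[OF L] that by (simp add: sector_def)
  moreover have "r' \<le> cmod (\<zeta> * of_real r)"
    using le \<zeta> r by (simp add: norm_mult)
  ultimately have "\<zeta> * of_real r = of_real (cmod (\<zeta> * of_real r))"
    using nz by (intro perron_peripheral_eigenvalue[of "sector m (- c)" V \<psi> r' w _ M]) auto
  then show False
    using \<zeta> r by (simp add: norm_mult)
qed

lemma intertwines_unit_eigenvalue:
  assumes V: "sector_positive m V" and m: "m > 0"
    and int: "intertwines m V h (\<lambda>y s. \<zeta> * h y s)"
    and \<zeta>: "cmod \<zeta> = 1" "\<zeta> \<noteq> 1"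
    and k: "k < m"
  shows "h k s = 0"
proof -
  have Vt: "sector_positive m (\<lambda>M N. V N M)"
    by (rule sector_positive_transpose[OF V])
  obtain r1 \<phi>1 where R1: "sector_perron m V 1 r1 \<phi>1"
    using sector_perron_exists[OF V m, of 1] by auto
  obtain r2 \<phi>2 where R2: "sector_perron m V (- 1) r2 \<phi>2"
    using sector_perron_exists[OF V m, of "- 1"] by auto
  obtain l1 \<psi>1 where L1: "sector_perron m (\<lambda>M N. V N M) 1 l1 \<psi>1"
    using sector_perron_exists[OF Vt m, of 1] by auto
  obtain l2 \<psi>2 where L2: "sector_perron m (\<lambda>M N. V N M) (- 1) l2 \<psi>2"
    using sector_perron_exists[OF Vt m, of "- 1"] by auto
  have l: "l1 = r1" "l2 = r2"
    using sector_perron_transpose_eq(2)[OF m _ R1 L1] sector_perron_transpose_eq(2)[OF m _ R2 L2]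
    by auto
  obtain c r r' \<phi> \<psi> \<phi>' \<psi>' where c: "c = 1 \<or> c = - 1"
    and R: "sector_perron m V c r \<phi>" and L: "sector_perron m (\<lambda>M N. V N M) c r \<psi>"
    and R': "sector_perron m V (- c) r' \<phi>'" and L': "sector_perron m (\<lambda>M N. V N M) (- c) r' \<psi>'"
    and le: "r' \<le> r"
  proof (cases "r2 \<le> r1")
    case True
    then show ?thesis using that[of 1 r1 \<phi>1 \<psi>1 r2 \<phi>2 \<psi>2] R1 R2 L1 L2 l by simp
  next
    case False
    then show ?thesis using that[of "- 1" r2 \<phi>2 \<psi>2 r1 \<phi>1 \<psi>1] R1 R2 L1 L2 l by simp
  qed
  let ?P = "Pow {..<m}" and ?\<phi> = "\<lambda>N. complex_of_real (\<phi> N)" and ?\<psi> = "\<lambda>N. complex_of_real (\<psi> N)"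
    and ?V = "\<lambda>M N. complex_of_real (V M N)"
  have int': "fermion m (adj h) (?V M) N = \<zeta> * fermion m h (\<lambda>K. ?V K N) M" if "M \<in> ?P" "N \<in> ?P" for M N
    using int that by (simp add: intertwines_def fermion_scale_coeff)
  have eigR: "(\<Sum>N\<in>?P. ?V M N * ?\<phi> N) = of_real r * ?\<phi> M" if "M \<subseteq> {..<m}" for M
  proof -
    have "(\<Sum>N\<in>?P. V M N * \<phi> N) = r * \<phi> M"
      using sector_perronD(4)[OF R that] .
    then show ?thesis by (simp flip: of_real_mult of_real_sum)
  qed
  have eigL: "(\<Sum>M\<in>?P. ?\<psi> M * ?V M N) = of_real r * ?\<psi> N" if "N \<subseteq> {..<m}" for N
  proof -
    have "(\<Sum>M\<in>?P. \<psi> M * V M N) = r * \<psi> N"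
      using sector_perronD(4)[OF L that] by (simp add: mult.commute)
    then show ?thesis by (simp flip: of_real_mult of_real_sum)
  qed
  have killR: "fermion m h ?\<phi> M = 0" if "M \<subseteq> {..<m}" for M
  proof (rule fermion_kills_perron[OF V m c R L' le \<zeta> _ that])
    fix M assume M: "M \<subseteq> {..<m}"
    have "(\<Sum>N\<in>?P. ?V M N * fermion m h ?\<phi> N) = (\<Sum>N\<in>?P. fermion m (adj h) (?V M) N * ?\<phi> N)"
      by (rule fermion_adjoint)
    also have "\<dots> = \<zeta> * (\<Sum>N\<in>?P. fermion m h (\<lambda>K. ?V K N) M * ?\<phi> N)"
      unfolding sum_distrib_left using int' M by (intro sum.cong) auto
    also have "(\<Sum>N\<in>?P. fermion m h (\<lambda>K. ?V K N) M * ?\<phi> N) = fermion m h (\<lambda>K. \<Sum>N\<in>?P. ?V K N * ?\<phi> N) M"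
      by (simp add: fermion_sum')
    also have "\<dots> = fermion m h (\<lambda>K. of_real r * ?\<phi> K) M"
      by (rule fermion_cong[OF M eigR])
    finally show "(\<Sum>N\<in>?P. ?V M N * fermion m h ?\<phi> N) = \<zeta> * of_real r * fermion m h ?\<phi> M"
      by (simp add: fermion_scale)
  qed
  have \<zeta>': "cmod (inverse \<zeta>) = 1" "inverse \<zeta> \<noteq> 1" "\<zeta> \<noteq> 0"
    using \<zeta> by (auto simp: norm_inverse)
  have killL: "fermion m (adj h) ?\<psi> N = 0" if "N \<subseteq> {..<m}" for N
  proof (rule fermion_kills_perron[OF Vt m c L _ le \<zeta>'(1,2) _ that])
    show "sector_perron m (\<lambda>M N. V M N) (- c) r' \<phi>'" by (rule R')
    fix N assume N: "N \<subseteq> {..<m}"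
    have "(\<Sum>M\<in>?P. fermion m (adj h) ?\<psi> M * ?V M N) = (\<Sum>M\<in>?P. ?\<psi> M * fermion m h (\<lambda>K. ?V K N) M)"
      using fermion_adjoint[where m = m and \<Phi>' = ?\<psi> and h = h and \<Phi> = "\<lambda>K. ?V K N"] by simp
    also have "\<dots> = inverse \<zeta> * (\<Sum>M\<in>?P. ?\<psi> M * fermion m (adj h) (?V M) N)"
      unfolding sum_distrib_left using int' N \<zeta>' by (intro sum.cong) auto
    also have "(\<Sum>M\<in>?P. ?\<psi> M * fermion m (adj h) (?V M) N) = fermion m (adj h) (\<lambda>K. \<Sum>M\<in>?P. ?\<psi> M * ?V M K) N"
      by (simp add: fermion_sum)
    also have "\<dots> = fermion m (adj h) (\<lambda>K. of_real r * ?\<psi> K) N"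
      by (rule fermion_cong[OF N eigL])
    finally show "(\<Sum>M\<in>?P. ?V M N * fermion m (adj h) ?\<psi> M)
        = inverse \<zeta> * of_real r * fermion m (adj h) ?\<psi> N"
      by (simp add: fermion_scale mult.commute)
  qed
  define e where "e y t = (if y = k \<and> t = (\<not> s) then 1 else 0 :: complex)" for y t
  have anti: "fermion m h (fermion m e ?\<phi>) M + fermion m e (fermion m h ?\<phi>) M = h k s * ?\<phi> M" for M
  proof -
    have "(\<Sum>y<m. h y True * e y False + e y True * h y False) = (\<Sum>y<m. if y = k then h k s else 0)"
      by (rule sum.cong) (auto simp: e_def)
    then show ?thesis
      using k unfolding fermion_anticommute by simp
  qed
  have "h k s * (\<Sum>M\<in>?P. ?\<psi> M * ?\<phi> M) = (\<Sum>M\<in>?P. ?\<psi> M * (h k s * ?\<phi> M))"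
    by (simp add: sum_distrib_left mult_ac)
  also have "\<dots> = (\<Sum>M\<in>?P. ?\<psi> M * fermion m h (fermion m e ?\<phi>) M)
      + (\<Sum>M\<in>?P. ?\<psi> M * fermion m e (fermion m h ?\<phi>) M)"
    by (simp add: anti[symmetric] distrib_left sum.distrib)
  also have "(\<Sum>M\<in>?P. ?\<psi> M * fermion m h (fermion m e ?\<phi>) M) = 0"
    by (subst fermion_adjoint) (use killL in \<open>auto intro!: sum.neutral\<close>)
  also have "(\<Sum>M\<in>?P. ?\<psi> M * fermion m e (fermion m h ?\<phi>) M) = 0"
    by (subst fermion_adjoint) (use killR in \<open>auto intro!: sum.neutral\<close>)
  finally have "h k s * of_real (\<Sum>M\<in>?P. \<psi> M * \<phi> M) = 0"
    by simp
  moreover have "(\<Sum>M\<in>?P. \<psi> M * \<phi> M) \<noteq> 0"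
    using sector_perron_transpose_eq(1)[OF m c R L] by simp
  then have "complex_of_real (\<Sum>M\<in>?P. \<psi> M * \<phi> M) \<noteq> 0"
    by (simp only: of_real_eq_0_iff simp_thms)
  ultimately show ?thesis
    by (simp only: mult_eq_0_iff simp_thms)
qed


section \<open>One turn around the cylinder\<close>

text \<open>
  The diagonal operator that carries the weights of the \<open>b\<close>-edges and moves a fermion from the
  left ends of these edges to the right ends.
\<close>

definition edge_weight :: "nat \<Rightarrow> (nat \<Rightarrow> real) \<Rightarrow> nat set \<Rightarrow> real" where
  "edge_weight m \<beta> N = (\<Prod>y<m. if y \<in> N then 1 else \<beta> y)"

lemma edge_weight_flip:
  assumes "k < m" "k \<in> N"
  shows "edge_weight m \<beta> (flip k N) = \<beta> k * edge_weight m \<beta> N"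
proof -
  have "(\<Prod>y\<in>{..<m} - {k}. if y \<in> flip k N then 1 else \<beta> y) = (\<Prod>y\<in>{..<m} - {k}. if y \<in> N then 1 else \<beta> y)"
    by (rule prod.cong) auto
  then show ?thesis
    using assms by (simp add: edge_weight_def prod.remove[of "{..<m}" k])
qed

lemma intertwines_edge_weight:
  assumes int: "intertwines m V h h'"
    and T: "\<And>y. y < m \<Longrightarrow> h' y True = of_real (\<beta> y) * h'' y True"
    and F: "\<And>y. y < m \<Longrightarrow> h'' y False = of_real (\<beta> y) * h' y False"
  shows "intertwines m (\<lambda>N' N. edge_weight m \<beta> N' * V N' N) h h''"
  unfolding intertwines_def
proof (intro ballI)
  fix M N assume M: "M \<in> Pow {..<m}" and N: "N \<in> Pow {..<m}"
  let ?D = "\<lambda>N. complex_of_real (edge_weight m \<beta> N)"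
  have *: "?D M * h' y (y \<in> M) = h'' y (y \<in> M) * ?D (flip y M)" if y: "y < m" for y
  proof (cases "y \<in> M")
    case True
    then show ?thesis using edge_weight_flip[OF y True, of \<beta>] T[OF y] by simp
  next
    case False
    then have "edge_weight m \<beta> M = \<beta> y * edge_weight m \<beta> (flip y M)"
      using edge_weight_flip[OF y, of "flip y M" \<beta>] by simp
    then show ?thesis using F[OF y] False by simp
  qed
  have "fermion m (adj h) (\<lambda>N. of_real (edge_weight m \<beta> M * V M N)) N
      = ?D M * fermion m (adj h) (\<lambda>N. of_real (V M N)) N"
    by (simp add: fermion_scale)
  also have "\<dots> = ?D M * fermion m h' (\<lambda>K. of_real (V K N)) M"
    using int M N by (simp add: intertwines_def)
  also have "\<dots> = fermion m h'' (\<lambda>K. of_real (edge_weight m \<beta> K * V K N)) M"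
    unfolding fermion_def sum_distrib_left
  proof (rule sum.cong[OF refl])
    fix y assume "y \<in> {..<m}"
    then show "?D M * (string_sign M y * h' y (y \<in> M) * of_real (V (flip y M) N))
      = string_sign M y * h'' y (y \<in> M) * of_real (edge_weight m \<beta> (flip y M) * V (flip y M) N)"
      using *[of y] by (simp add: mult_ac)
  qed
  finally show "fermion m (adj h) (\<lambda>N. of_real (edge_weight m \<beta> M * V M N)) N
      = fermion m h'' (\<lambda>K. of_real (edge_weight m \<beta> K * V K N)) M" .
qed

lemma intertwines_scale:
  assumes "intertwines m V h h'"
  shows "intertwines m V (\<lambda>y s. c * h y s) (\<lambda>y s. c * h' y s)"
proof -
  have "adj (\<lambda>y s. c * h y s) = (\<lambda>y s. c * adj h y s)"
    by (simp add: adj_def fun_eq_iff)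
  then show ?thesis
    using assms by (simp add: intertwines_def fermion_scale_coeff)
qed

text \<open>
  A kernel vector, with all triangular weights equal to 1, lifted to the universal cover of the
  cylinder; it is multiplied by \<open>z\<close> when going once around.
\<close>

locale strip_kernel =
  fixes m n :: nat and z :: complex
    and A B C :: "nat \<Rightarrow> nat \<Rightarrow> real"
    and Fa Fb Fc Ga Gb Gc :: "nat \<Rightarrow> nat \<Rightarrow> complex"
  assumes m: "m > 0" and n: "n > 0"
    and A_pos: "\<And>x y. y < m \<Longrightarrow> A x y > 0"
    and B_pos: "\<And>x y. y < m \<Longrightarrow> B x y > 0"
    and C_pos: "\<And>x y. Suc y < m \<Longrightarrow> C x y > 0"
    and beta_a: "\<And>x y. y < m \<Longrightarrow> Fb x y - Fc x y + A x y * Ga x y = 0"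
    and beta_b: "\<And>x y. y < m \<Longrightarrow> Fc x y - Fa x y + B x y * Gb (Suc x) y = 0"
    and beta_c: "\<And>x y. Suc y < m \<Longrightarrow> Fa x y - Fb x y + C x y * Gc x (Suc y) = 0"
    and beta_c_last: "\<And>x. Fa x (m - 1) - Fb x (m - 1) = 0"
    and omega_a: "\<And>x y. y < m \<Longrightarrow> Gb x y - Gc x y - A x y * Fa x y = 0"
    and omega_b: "\<And>x y. y < m \<Longrightarrow> Gc (Suc x) y - Ga (Suc x) y - B x y * Fb x y = 0"
    and omega_c: "\<And>x y. Suc y < m \<Longrightarrow> Ga x (Suc y) - Gb x (Suc y) - C x y * Fc x y = 0"
    and omega_c_first: "\<And>x. Ga x 0 - Gb x 0 = 0"
    and B_periodic: "\<And>x y. B (x + n) y = B x y"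
    and Fb_periodic: "\<And>x y. Fb (x + n) y = z * Fb x y"
    and Gb_periodic: "\<And>x y. Gb (x + n) y = z * Gb x y"
begin

definition cut :: "nat \<Rightarrow> nat \<Rightarrow> bool \<Rightarrow> complex" where
  "cut x y s = (if s then Gb (Suc x) y else B x y * Fb x y)"

definition column_weights :: "nat \<Rightarrow> nat \<Rightarrow> real" where
  "column_weights x i = (if even i then A x (i div 2) else if i = 2 * m - 1 then 0 else C x (i div 2))"

definition transfer :: "nat \<Rightarrow> nat set \<Rightarrow> nat set \<Rightarrow> real" where
  "transfer x N' N = edge_weight m (B (Suc x)) N' * column_matrix m (column_weights (Suc x)) N' N"

lemma column_weights_last: "column_weights x (2 * m - 1) = 0"
  using m by (auto simp: column_weights_def)

lemma column_weights_pos: "i < 2 * m - 1 \<Longrightarrow> column_weights x i > 0"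
  using m by (auto simp: column_weights_def intro!: A_pos C_pos elim!: oddE)

lemma transfer_sector_positive: "sector_positive m (transfer x)"
proof -
  have D: "edge_weight m (B (Suc x)) N' > 0" for N'
    unfolding edge_weight_def by (intro prod_pos) (auto intro: B_pos)
  show ?thesis
    unfolding sector_positive_def transfer_def
  proof (intro ballI)
    fix M N
    show "if string_sign M m = string_sign N m
      then edge_weight m (B (Suc x)) M * column_matrix m (column_weights (Suc x)) M N > 0
      else edge_weight m (B (Suc x)) M * column_matrix m (column_weights (Suc x)) M N = 0"
    proof (cases "string_sign M m = string_sign N m")
      case True
      then have "column_matrix m (column_weights (Suc x)) M N > 0"
        by (intro column_matrix_pos m column_weights_last column_weights_pos) auto
      with True D[of M] show ?thesis by simp
    next
      case False
      then have "column_matrix m (column_weights (Suc x)) M N = 0"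
        by (intro column_matrix_zero m column_weights_last) auto
      with False show ?thesis by simp
    qed
  qed
qed

lemma transfer_intertwines: "intertwines m (transfer x) (cut x) (\<lambda>y s. - cut (Suc x) y s)"
proof -
  let ?X = "Suc x"
  define u where "u i = (if even i then Gb else Fb) ?X (i div 2)" for i
  define d where "d i = (if even i then B x (i div 2) * Fb x (i div 2)
    else B ?X (i div 2) * Gb (Suc ?X) (i div 2))" for i
  define p where "p i = (if even i then Gc else Fa) ?X (i div 2)" for i
  define q where "q i = (if even i then Ga else Fc) ?X (i div 2)" for i
  let ?w = "column_weights ?X"
  have q0: "q 0 = u 0"
    using omega_c_first[of ?X] by (simp add: q_def u_def)
  have qS: "q (Suc i) = u (Suc i) + of_real (?w i) * q i" if "Suc i < 2 * m" for i
  proof (cases "even i")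
    case True
    then obtain y where y: "i = 2 * y" by (elim evenE)
    then show ?thesis
      using that beta_a[of y ?X] by (simp add: q_def u_def column_weights_def algebra_simps)
  next
    case False
    then obtain y where y: "i = Suc (2 * y)" by (metis oddE Suc_eq_plus1)
    then show ?thesis
      using that omega_c[of y ?X] by (simp add: q_def u_def column_weights_def algebra_simps)
  qed
  have pu: "u i = p i + of_real (?w i) * p (Suc i)" if "i < 2 * m" for i
  proof (cases "even i")
    case True
    then obtain y where y: "i = 2 * y" by (elim evenE)
    then show ?thesis
      using that omega_a[of y ?X] by (simp add: p_def u_def column_weights_def algebra_simps)
  next
    case False
    then obtain y where y: "i = Suc (2 * y)" by (metis oddE Suc_eq_plus1)
    show ?thesis
    proof (cases "Suc y < m")
      case True
      moreover from True y have "i \<noteq> 2 * m - 1" by linarith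
      ultimately show ?thesis
        using y beta_c[of y ?X] by (simp add: p_def u_def column_weights_def algebra_simps)
    next
      case False
      then have "i = 2 * m - 1" and i: "odd i" "i div 2 = m - 1"
        using y that by simp_all
      then have "?w i = 0"
        using column_weights_last by simp
      with i show ?thesis
        using beta_c_last[of ?X] by (simp add: p_def u_def)
    qed
  qed
  have dpq: "d i = p i - q i" if "i < 2 * m" for i
  proof (cases "even i")
    case True
    then obtain y where y: "i = 2 * y" by (elim evenE)
    then show ?thesis
      using that omega_b[of y x] by (simp add: p_def q_def d_def)
  next
    case False
    then obtain y where y: "i = Suc (2 * y)" by (metis oddE Suc_eq_plus1)
    moreover from y have "B ?X y * Gb (Suc ?X) y = - (Fc ?X y - Fa ?X y)"
      using that beta_b[of y ?X] by (simp only: add_eq_0_iff)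
    ultimately show ?thesis
      by (simp add: p_def q_def d_def)
  qed
  let ?h' = "\<lambda>y s. - (if s then B ?X y * Gb (Suc ?X) y else Fb ?X y)"
  have "intertwines m (column_matrix m ?w) (cut x) ?h'"
    unfolding intertwines_def
  proof (intro ballI)
    fix N' N
    have "(\<Sum>y<m. string_sign N y * (if y \<in> N then d (2 * y) else u (2 * y))
             * of_real (column_matrix m ?w N' (flip y N)))
       = - (\<Sum>y<m. string_sign N' y * (if y \<in> N' then d (Suc (2 * y)) else u (Suc (2 * y)))
             * of_real (column_matrix m ?w (flip y N') N))"
      by (rule column_identity[OF q0 qS pu dpq m column_weights_last])
    moreover have "fermion m (adj (cut x)) (\<lambda>N. of_real (column_matrix m ?w N' N)) N
      = (\<Sum>y<m. string_sign N y * (if y \<in> N then d (2 * y) else u (2 * y))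
             * of_real (column_matrix m ?w N' (flip y N)))"
      unfolding fermion_def by (rule sum.cong) (auto simp: adj_def cut_def d_def u_def)
    moreover have "fermion m ?h' (\<lambda>M. of_real (column_matrix m ?w M N)) N'
      = - (\<Sum>y<m. string_sign N' y * (if y \<in> N' then d (Suc (2 * y)) else u (Suc (2 * y)))
             * of_real (column_matrix m ?w (flip y N') N))"
      unfolding fermion_def sum_negf[symmetric] by (rule sum.cong) (auto simp: d_def u_def)
    ultimately show "fermion m (adj (cut x)) (\<lambda>N. of_real (column_matrix m ?w N' N)) N
      = fermion m ?h' (\<lambda>M. of_real (column_matrix m ?w M N)) N'"
      by (simp only:)
  qed
  then have "intertwines m (\<lambda>N' N. edge_weight m (B ?X) N' * column_matrix m ?w N' N) (cut x)
      (\<lambda>y s. - cut ?X y s)"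
    by (rule intertwines_edge_weight) (simp_all add: cut_def)
  then show ?thesis
    by (simp add: transfer_def[abs_def])
qed

lemma transfer_power:
  "\<exists>V. sector_positive m V \<and> intertwines m V (cut x) (\<lambda>y s. (- 1) ^ Suc k * cut (x + Suc k) y s)"
proof (induction k)
  case 0
  show ?case
    using transfer_sector_positive[of x] transfer_intertwines[of x] by auto
next
  case (Suc k)
  then obtain V where V: "sector_positive m V"
    "intertwines m V (cut x) (\<lambda>y s. (- 1) ^ Suc k * cut (x + Suc k) y s)" by blast
  have "intertwines m (transfer (x + Suc k)) (\<lambda>y s. (- 1) ^ Suc k * cut (x + Suc k) y s)
      (\<lambda>y s. (- 1) ^ Suc k * - cut (Suc (x + Suc k)) y s)"
    by (intro intertwines_scale transfer_intertwines)
  from intertwines_comp[OF V(2) this] sector_positive_comp[OF transfer_sector_positive V(1)]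
  show ?case by auto
qed

lemma cut_eq_0:
  assumes z: "cmod z = 1" "z \<noteq> (- 1) ^ n" and y: "y < m"
  shows "cut x y s = 0"
proof -
  obtain k where k: "n = Suc k" using n by (cases n) auto
  obtain V where V: "sector_positive m V"
    "intertwines m V (cut x) (\<lambda>y s. (- 1) ^ n * cut (x + n) y s)"
    using transfer_power[of x k] k by auto
  have "cut (x + n) y s = z * cut x y s" for y s
    using Gb_periodic[of "Suc x" y] by (simp add: cut_def B_periodic Fb_periodic)
  then have "intertwines m V (cut x) (\<lambda>y s. (- 1) ^ n * z * cut x y s)"
    using V(2) by (simp add: mult.assoc)
  moreover have "cmod ((- 1) ^ n * z) = 1"
    using z by (simp add: norm_mult norm_power)
  moreover have "(- 1) ^ n * z \<noteq> 1"
  proof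
    assume "(- 1) ^ n * z = 1"
    then have "(- 1) ^ n * ((- 1) ^ n * z) = (- 1) ^ n" by simp
    then show False using z by (simp add: mult.assoc[symmetric] power_mult_distrib[symmetric])
  qed
  ultimately show ?thesis
    using intertwines_unit_eigenvalue[OF V(1) m _ _ _ y] by blast
qed

lemma kernel_eq_0:
  assumes z: "cmod z = 1" "z \<noteq> (- 1) ^ n" and y: "y < m"
  shows "Fa (Suc x) y = 0 \<and> Fb (Suc x) y = 0 \<and> Fc (Suc x) y = 0
    \<and> Ga (Suc x) y = 0 \<and> Gb (Suc x) y = 0 \<and> Gc (Suc x) y = 0"
proof -
  have Gb: "Gb (Suc x) y = 0" if "y < m" for x y
    using cut_eq_0[OF z that, of x True] by (simp add: cut_def)
  have Fb: "Fb x y = 0" if "y < m" for x y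
    using cut_eq_0[OF z that, of x False] B_pos[OF that, of x] by (simp add: cut_def)
  have Fc_if: "Fc (Suc x) y = 0" if "y < m" "Ga (Suc x) y = 0" for y
    using that beta_a[of y "Suc x"] Fb[of y "Suc x"] by simp
  have Ga: "Ga (Suc x) y = 0" using y
  proof (induction y)
    case 0
    then show ?case using omega_c_first[of "Suc x"] Gb[of 0 x] by simp
  next
    case (Suc y)
    then show ?case using omega_c[of y "Suc x"] Gb[of "Suc y" x] Fc_if[of y] by simp
  qed
  moreover from this have Fc: "Fc (Suc x) y = 0" using Fc_if y by blast
  moreover have "Fa (Suc x) y = 0"
    using beta_b[OF y, of "Suc x"] Gb[OF y, of "Suc x"] Fc by simp
  moreover have "Gc (Suc x) y = 0"
    using omega_b[OF y, of x] Fb[OF y, of x] Ga by simp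
  ultimately show ?thesis
    using Gb[OF y] Fb[OF y] by simp
qed

end


section \<open>Kernel vectors of the Kasteleyn matrix\<close>

lemma next_dir_eq_iff:
  "next_dir s = Dir_a \<longleftrightarrow> s = Dir_c" "next_dir s = Dir_b \<longleftrightarrow> s = Dir_a" "next_dir s = Dir_c \<longleftrightarrow> s = Dir_b"
  "Dir_a = next_dir s \<longleftrightarrow> s = Dir_c" "Dir_b = next_dir s \<longleftrightarrow> s = Dir_a" "Dir_c = next_dir s \<longleftrightarrow> s = Dir_b"
  by (cases s; simp)+

lemma fisher_edge_Beta_iff:
  "fisher_edge m n (Beta s x y) v \<longleftrightarrow> x < n \<and> y < m \<and>
     (v = Beta (next_dir s) x y \<or> s = Dir_a \<and> v = Omega Dir_a x y
      \<or> s = Dir_b \<and> v = Omega Dir_b ((x + 1) mod n) y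
      \<or> s = Dir_c \<and> y + 1 < m \<and> v = Omega Dir_c x (y + 1))"
  (is "?L \<longleftrightarrow> ?R")
proof
  show "?L \<Longrightarrow> ?R"
    by (auto elim: fisher_edge.cases)
  show "?R \<Longrightarrow> ?L"
    by (elim conjE disjE) (simp_all only: fisher_edge.intros)
qed

lemma fisher_edge_Omega_iff:
  "fisher_edge m n (Omega s x y) v \<longleftrightarrow> x < n \<and> y < m \<and> v = Omega (next_dir s) x y"
  by (auto elim: fisher_edge.cases intro: fisher_edge.intros)

lemma z_edge_Beta_iff:
  "z_edge m n (Beta s x y) v \<longleftrightarrow> y < m \<and> s = Dir_b \<and> x = n - 1 \<and> v = Omega Dir_b 0 y"
  by (auto simp: z_edge_def)

lemma z_edge_Omega: "\<not> z_edge m n (Omega s x y) v"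
  by (auto simp: z_edge_def)

lemma Suc_mod_inj: "x < n \<Longrightarrow> x' < n \<Longrightarrow> Suc x mod n = Suc x' mod n \<longleftrightarrow> x = x'"
  by (auto simp: mod_Suc split: if_splits)

lemma finite_fisher_vertices: "finite (fisher_vertices m n)"
  by (simp flip: set_vertex_list)

lemma in_fisher_vertices [simp]:
  "Beta s x y \<in> fisher_vertices m n \<longleftrightarrow> x < n \<and> y < m"
  "Omega s x y \<in> fisher_vertices m n \<longleftrightarrow> x < n \<and> y < m"
  by (auto simp: fisher_vertices_def)

definition kasteleyn_row ::
  "nat \<Rightarrow> nat \<Rightarrow> (vertex \<Rightarrow> vertex \<Rightarrow> real) \<Rightarrow> complex \<Rightarrow> (vertex \<Rightarrow> complex) \<Rightarrow> vertex \<Rightarrow> complex" where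
  "kasteleyn_row m n W z f u = (\<Sum>v\<in>fisher_vertices m n. kasteleyn_entry m n W z u v * f v)"

lemma kasteleyn_row_restrict:
  assumes "T \<subseteq> fisher_vertices m n"
    and "\<And>v. fisher_edge m n u v \<or> fisher_edge m n v u \<Longrightarrow> v \<in> T"
  shows "kasteleyn_row m n W z f u = (\<Sum>v\<in>T. kasteleyn_entry m n W z u v * f v)"
  unfolding kasteleyn_row_def
  by (rule sum.mono_neutral_right)
     (use assms in \<open>auto simp: kasteleyn_entry_def finite_fisher_vertices\<close>)

lemma fisher_edge_to_Beta_iff:
  "fisher_edge m n v (Beta s x y) \<longleftrightarrow> x < n \<and> y < m \<and> v = Beta (next_dir (next_dir s)) x y"
  by (cases v; cases s) (auto simp: fisher_edge_Beta_iff fisher_edge_Omega_iff next_dir_eq_iff)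

lemma fisher_edge_to_Omega_a_iff:
  "fisher_edge m n v (Omega Dir_a x y) \<longleftrightarrow> x < n \<and> y < m \<and>
     (v = Omega Dir_c x y \<or> v = Beta Dir_a x y)"
  by (cases v) (auto simp: fisher_edge_Beta_iff fisher_edge_Omega_iff next_dir_eq_iff)

lemma fisher_edge_to_Omega_b_iff:
  assumes "x < n"
  shows "fisher_edge m n v (Omega Dir_b (Suc x mod n) y) \<longleftrightarrow> y < m \<and>
     (v = Omega Dir_a (Suc x mod n) y \<or> v = Beta Dir_b x y)"
  using assms
  by (cases v) (auto simp: fisher_edge_Beta_iff fisher_edge_Omega_iff next_dir_eq_iff Suc_mod_inj)

lemma fisher_edge_to_Omega_c_iff:
  "fisher_edge m n v (Omega Dir_c x y) \<longleftrightarrow> x < n \<and> y < m \<and>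
     (v = Omega Dir_b x y \<or> y > 0 \<and> v = Beta Dir_c x (y - 1))"
  by (cases v) (auto simp: fisher_edge_Beta_iff fisher_edge_Omega_iff next_dir_eq_iff)

lemmas kasteleyn_simps = kasteleyn_entry_def fisher_edge_Beta_iff fisher_edge_Omega_iff
  z_edge_Beta_iff z_edge_Omega next_dir_eq_iff

lemma kasteleyn_row_Beta_a:
  assumes "x < n" "y < m"
  shows "kasteleyn_row m n W z f (Beta Dir_a x y)
    = W (Beta Dir_a x y) (Beta Dir_b x y) * f (Beta Dir_b x y)
      - W (Beta Dir_c x y) (Beta Dir_a x y) * f (Beta Dir_c x y)
      + W (Beta Dir_a x y) (Omega Dir_a x y) * f (Omega Dir_a x y)"
  by (subst kasteleyn_row_restrict[where T = "{Beta Dir_b x y, Beta Dir_c x y, Omega Dir_a x y}"])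
     (use assms in \<open>auto simp: kasteleyn_simps fisher_edge_to_Beta_iff\<close>)

lemma kasteleyn_row_Beta_b:
  assumes "x < n" "y < m"
  shows "kasteleyn_row m n W z f (Beta Dir_b x y)
    = W (Beta Dir_b x y) (Beta Dir_c x y) * f (Beta Dir_c x y)
      - W (Beta Dir_a x y) (Beta Dir_b x y) * f (Beta Dir_a x y)
      + (if x = n - 1 then z else 1) * W (Beta Dir_b x y) (Omega Dir_b (Suc x mod n) y)
          * f (Omega Dir_b (Suc x mod n) y)"
  by (subst kasteleyn_row_restrict[where
        T = "{Beta Dir_c x y, Beta Dir_a x y, Omega Dir_b (Suc x mod n) y}"])
     (use assms in \<open>auto simp: kasteleyn_simps fisher_edge_to_Beta_iff\<close>)

lemma kasteleyn_row_Beta_c: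
  assumes "x < n" "y < m"
  shows "kasteleyn_row m n W z f (Beta Dir_c x y)
    = W (Beta Dir_c x y) (Beta Dir_a x y) * f (Beta Dir_a x y)
      - W (Beta Dir_b x y) (Beta Dir_c x y) * f (Beta Dir_b x y)
      + (if Suc y < m then W (Beta Dir_c x y) (Omega Dir_c x (Suc y)) * f (Omega Dir_c x (Suc y)) else 0)"
proof (cases "Suc y < m")
  case True
  then show ?thesis
    by (subst kasteleyn_row_restrict[where T = "{Beta Dir_a x y, Beta Dir_b x y, Omega Dir_c x (Suc y)}"])
       (use assms in \<open>auto simp: kasteleyn_simps fisher_edge_to_Beta_iff\<close>)
next
  case False
  then show ?thesis
    by (subst kasteleyn_row_restrict[where T = "{Beta Dir_a x y, Beta Dir_b x y}"])
       (use assms in \<open>auto simp: kasteleyn_simps fisher_edge_to_Beta_iff\<close>)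
qed

lemma kasteleyn_row_Omega_a:
  assumes "x < n" "y < m"
  shows "kasteleyn_row m n W z f (Omega Dir_a x y)
    = W (Omega Dir_a x y) (Omega Dir_b x y) * f (Omega Dir_b x y)
      - W (Omega Dir_c x y) (Omega Dir_a x y) * f (Omega Dir_c x y)
      - W (Beta Dir_a x y) (Omega Dir_a x y) * f (Beta Dir_a x y)"
  by (subst kasteleyn_row_restrict[where T = "{Omega Dir_b x y, Omega Dir_c x y, Beta Dir_a x y}"])
     (use assms in \<open>auto simp: kasteleyn_simps fisher_edge_to_Omega_a_iff\<close>)

lemma kasteleyn_row_Omega_b:
  assumes "x < n" "y < m"
  defines "x' \<equiv> Suc x mod n"
  shows "kasteleyn_row m n W z f (Omega Dir_b x' y)
    = W (Omega Dir_b x' y) (Omega Dir_c x' y) * f (Omega Dir_c x' y)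
      - W (Omega Dir_a x' y) (Omega Dir_b x' y) * f (Omega Dir_a x' y)
      - inverse (if x = n - 1 then z else 1) * W (Beta Dir_b x y) (Omega Dir_b x' y) * f (Beta Dir_b x y)"
proof -
  have x': "x' < n" "x' = Suc x mod n"
    using assms by (auto simp: x'_def)
  show ?thesis
    by (subst kasteleyn_row_restrict[where T = "{Omega Dir_c x' y, Omega Dir_a x' y, Beta Dir_b x y}"])
       (use assms x' in \<open>auto simp: kasteleyn_simps fisher_edge_to_Omega_b_iff\<close>)
qed

lemma kasteleyn_row_Omega_c:
  assumes "x < n" "y < m"
  shows "kasteleyn_row m n W z f (Omega Dir_c x y)
    = W (Omega Dir_c x y) (Omega Dir_a x y) * f (Omega Dir_a x y)
      - W (Omega Dir_b x y) (Omega Dir_c x y) * f (Omega Dir_b x y)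
      - (if y > 0 then W (Beta Dir_c x (y - 1)) (Omega Dir_c x y) * f (Beta Dir_c x (y - 1)) else 0)"
proof (cases "y > 0")
  case True
  then show ?thesis
    by (subst kasteleyn_row_restrict[where T = "{Omega Dir_a x y, Omega Dir_b x y, Beta Dir_c x (y - 1)}"])
       (use assms in \<open>auto simp: kasteleyn_simps fisher_edge_to_Omega_c_iff\<close>)
next
  case False
  then show ?thesis
    by (subst kasteleyn_row_restrict[where T = "{Omega Dir_a x y, Omega Dir_b x y}"])
       (use assms in \<open>auto simp: kasteleyn_simps fisher_edge_to_Omega_c_iff\<close>)
qed

lemma Suc_div_mod:
  fixes n :: nat
  assumes "n > 0"
  shows "Suc x mod n = Suc (x mod n) mod n"
    and "(z :: complex) ^ (Suc x div n) = z ^ (x div n) * (if x mod n = n - 1 then z else 1)"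
  using assms by (auto simp: mod_Suc div_Suc)

lemma kernel_trivial_normalised:
  fixes f :: "vertex \<Rightarrow> complex"
  assumes m: "m > 0" and n: "n > 0"
    and W: "\<And>u v. fisher_edge m n u v \<Longrightarrow> W u v > 0"
    and W_tri: "\<And>s x y. W (Beta s x y) (Beta (next_dir s) x y) = 1"
      "\<And>s x y. W (Omega s x y) (Omega (next_dir s) x y) = 1"
    and ker: "\<And>u. u \<in> fisher_vertices m n \<Longrightarrow> kasteleyn_row m n W z f u = 0"
    and z: "cmod z = 1" "z \<noteq> (- 1) ^ n"
    and u: "u \<in> fisher_vertices m n"
  shows "f u = 0"
proof -
  have z0: "z \<noteq> 0" using z by auto
  define F where "F s x y = z ^ (x div n) * f (Beta s (x mod n) y)" for s x y
  define G where "G s x y = z ^ (x div n) * f (Omega s (x mod n) y)" for s x y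
  define A where "A x y = W (Beta Dir_a (x mod n) y) (Omega Dir_a (x mod n) y)" for x y
  define B where "B x y = W (Beta Dir_b (x mod n) y) (Omega Dir_b (Suc x mod n) y)" for x y
  define C where "C x y = W (Beta Dir_c (x mod n) y) (Omega Dir_c (x mod n) (Suc y))" for x y
  note tri = W_tri[of Dir_a, simplified] W_tri[of Dir_b, simplified] W_tri[of Dir_c, simplified]
  have modn [simp]: "x mod n < n" for x using n by simp
  note step = Suc_div_mod[OF n]
  interpret strip_kernel m n z A B C "F Dir_a" "F Dir_b" "F Dir_c" "G Dir_a" "G Dir_b" "G Dir_c"
  proof
    fix x y assume y: "y < m"
    show "A x y > 0" unfolding A_def using y by (intro W) (simp add: fisher_edge_Beta_iff)
    show "B x y > 0" unfolding B_def using y by (intro W) (simp add: fisher_edge_Beta_iff step(1)[of x])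
    have "kasteleyn_row m n W z f (Beta Dir_a (x mod n) y) = 0" using y by (intro ker) simp
    then have "z ^ (x div n) * (f (Beta Dir_b (x mod n) y) - f (Beta Dir_c (x mod n) y)
        + A x y * f (Omega Dir_a (x mod n) y)) = 0"
      using y by (simp add: kasteleyn_row_Beta_a tri A_def)
    then show "F Dir_b x y - F Dir_c x y + A x y * G Dir_a x y = 0"
      by (simp add: F_def G_def algebra_simps)
    have "kasteleyn_row m n W z f (Beta Dir_b (x mod n) y) = 0" using y by (intro ker) simp
    then have "z ^ (x div n) * (f (Beta Dir_c (x mod n) y) - f (Beta Dir_a (x mod n) y)
        + (if x mod n = n - 1 then z else 1) * B x y * f (Omega Dir_b (Suc x mod n) y)) = 0"
      using y unfolding B_def step(1)[of x] by (subst (asm) kasteleyn_row_Beta_b) (simp_all add: tri)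
    then show "F Dir_c x y - F Dir_a x y + B x y * G Dir_b (Suc x) y = 0"
      unfolding F_def G_def step(2) by (simp only: distrib_left right_diff_distrib mult_ac)
    have "kasteleyn_row m n W z f (Omega Dir_a (x mod n) y) = 0" using y by (intro ker) simp
    then have "z ^ (x div n) * (f (Omega Dir_b (x mod n) y) - f (Omega Dir_c (x mod n) y)
        - A x y * f (Beta Dir_a (x mod n) y)) = 0"
      using y by (simp add: kasteleyn_row_Omega_a tri A_def)
    then show "G Dir_b x y - G Dir_c x y - A x y * F Dir_a x y = 0"
      by (simp add: F_def G_def algebra_simps)
    have "kasteleyn_row m n W z f (Omega Dir_b (Suc (x mod n) mod n) y) = 0" using y n by (intro ker) simp
    then have "z ^ (Suc x div n) * (f (Omega Dir_c (Suc x mod n) y) - f (Omega Dir_a (Suc x mod n) y)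
        - inverse (if x mod n = n - 1 then z else 1) * B x y * f (Beta Dir_b (x mod n) y)) = 0"
      using y unfolding B_def step(1)[of x] by (subst (asm) kasteleyn_row_Omega_b) (simp_all add: tri)
    moreover have regroup: "t * (a - b - i * \<beta> * c) = t * a - t * b - \<beta> * ((t * i) * c)"
      for t a b c i \<beta> :: complex
      by (simp add: algebra_simps)
    moreover have "z ^ (Suc x div n) * inverse (if x mod n = n - 1 then z else 1) = z ^ (x div n)"
      using z0 by (simp add: step(2))
    ultimately show "G Dir_c (Suc x) y - G Dir_a (Suc x) y - B x y * F Dir_b x y = 0"
      unfolding F_def G_def by (simp only: regroup)
  next
    fix x y assume y: "Suc y < m"
    show "C x y > 0" unfolding C_def using y by (intro W) (simp add: fisher_edge_Beta_iff)
    have "kasteleyn_row m n W z f (Beta Dir_c (x mod n) y) = 0" using y by (intro ker) simp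
    then have "z ^ (x div n) * (f (Beta Dir_a (x mod n) y) - f (Beta Dir_b (x mod n) y)
        + C x y * f (Omega Dir_c (x mod n) (Suc y))) = 0"
      using y by (simp add: kasteleyn_row_Beta_c tri C_def)
    then show "F Dir_a x y - F Dir_b x y + C x y * G Dir_c x (Suc y) = 0"
      by (simp add: F_def G_def algebra_simps)
    have "kasteleyn_row m n W z f (Omega Dir_c (x mod n) (Suc y)) = 0" using y by (intro ker) simp
    then have "z ^ (x div n) * (f (Omega Dir_a (x mod n) (Suc y)) - f (Omega Dir_b (x mod n) (Suc y))
        - C x y * f (Beta Dir_c (x mod n) y)) = 0"
      using y by (simp add: kasteleyn_row_Omega_c tri C_def)
    then show "G Dir_a x (Suc y) - G Dir_b x (Suc y) - C x y * F Dir_c x y = 0"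
      by (simp add: F_def G_def algebra_simps)
  next
    fix x
    have "kasteleyn_row m n W z f (Beta Dir_c (x mod n) (m - 1)) = 0" using m by (intro ker) simp
    then show "F Dir_a x (m - 1) - F Dir_b x (m - 1) = 0"
      using m by (simp add: kasteleyn_row_Beta_c tri F_def)
    have "kasteleyn_row m n W z f (Omega Dir_c (x mod n) 0) = 0" using m by (intro ker) simp
    then show "G Dir_a x 0 - G Dir_b x 0 = 0"
      using m by (simp add: kasteleyn_row_Omega_c tri G_def)
  next
    fix x y
    have "Suc (x + n) mod n = Suc x mod n"
      by (metis add_Suc mod_add_self2)
    then show "B (x + n) y = B x y" by (simp add: B_def)
  qed (use m n in \<open>simp_all add: F_def G_def\<close>)
  have zero: "f (Beta s x y) = 0 \<and> f (Omega s x y) = 0" if "x < n" "y < m" for s x y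
  proof -
    obtain k where k: "x + n = Suc k" using n by (cases "x + n") auto
    have "(x + n) div n = 1" "(x + n) mod n = x" using that n by simp_all
    then have "F s (x + n) y = z * f (Beta s x y)" "G s (x + n) y = z * f (Omega s x y)"
      by (simp_all add: F_def G_def)
    moreover have "F s (x + n) y = 0 \<and> G s (x + n) y = 0"
      using kernel_eq_0[OF z \<open>y < m\<close>, of k] unfolding k by (cases s) auto
    ultimately show ?thesis using z0 by simp
  qed
  show ?thesis
    using u zero by (auto simp: fisher_vertices_def)
qed

definition triangle_gauge :: "(dir \<Rightarrow> dir \<Rightarrow> real) \<Rightarrow> dir \<Rightarrow> real" where
  "triangle_gauge w s = sqrt (w (next_dir s) (next_dir (next_dir s))
     / (w s (next_dir s) * w (next_dir (next_dir s)) s))"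

lemma triangle_gauge:
  assumes "\<And>s. w s (next_dir s) > 0"
  shows "triangle_gauge w s > 0" "triangle_gauge w s * w s (next_dir s) * triangle_gauge w (next_dir s) = 1"
proof -
  have n3: "next_dir (next_dir (next_dir t)) = t" for t by (cases t) auto
  let ?p = "w s (next_dir s)" and ?q = "w (next_dir s) (next_dir (next_dir s))"
    and ?r = "w (next_dir (next_dir s)) s"
  have pos: "?p > 0" "?q > 0" "?r > 0"
    using assms[of s] assms[of "next_dir s"] assms[of "next_dir (next_dir s)"] by (simp_all add: n3)
  then show "triangle_gauge w s > 0"
    by (simp add: triangle_gauge_def)
  have "triangle_gauge w s * triangle_gauge w (next_dir s) = sqrt ((?q / (?p * ?r)) * (?r / (?q * ?p)))"
    by (simp add: triangle_gauge_def n3 flip: real_sqrt_mult)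
  also have "(?q / (?p * ?r)) * (?r / (?q * ?p)) = (1 / ?p)\<^sup>2"
    using pos by (simp add: field_simps power2_eq_square)
  also have "sqrt \<dots> = 1 / ?p"
    using pos by (subst real_sqrt_abs) simp
  finally have eq: "triangle_gauge w s * triangle_gauge w (next_dir s) = 1 / ?p" .
  have "triangle_gauge w s * ?p * triangle_gauge w (next_dir s)
      = (triangle_gauge w s * triangle_gauge w (next_dir s)) * ?p"
    by (simp only: mult_ac)
  also have "\<dots> = 1"
    using pos unfolding eq by simp
  finally show "triangle_gauge w s * ?p * triangle_gauge w (next_dir s) = 1" .
qed

lemma kasteleyn_row_gauge:
  assumes "\<And>v. g v > (0 :: real)"
  shows "kasteleyn_row m n (\<lambda>u v. g u * W u v * g v) z (\<lambda>v. f v / of_real (g v)) u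
    = of_real (g u) * kasteleyn_row m n W z f u"
proof -
  have "g v \<noteq> 0" for v using assms[of v] by simp
  then show ?thesis
    unfolding kasteleyn_row_def sum_distrib_left
    by (intro sum.cong) (auto simp: kasteleyn_entry_def)
qed

lemma kernel_trivial:
  fixes f :: "vertex \<Rightarrow> complex"
  assumes m: "m > 0" and n: "n > 0"
    and W: "\<And>u v. fisher_edge m n u v \<Longrightarrow> W u v > 0"
    and ker: "\<And>u. u \<in> fisher_vertices m n \<Longrightarrow> kasteleyn_row m n W z f u = 0"
    and z: "cmod z = 1" "z \<noteq> (- 1) ^ n"
    and u: "u \<in> fisher_vertices m n"
  shows "f u = 0"
proof -
  define W0 where "W0 u v = (if fisher_edge m n u v then W u v else 1)" for u v
  have W0: "W0 u v > 0" for u v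
    by (simp add: W0_def W)
  have "kasteleyn_entry m n W0 z u v = kasteleyn_entry m n W z u v" for u v
    by (simp add: kasteleyn_entry_def W0_def)
  then have ker0: "kasteleyn_row m n W0 z f u = 0" if "u \<in> fisher_vertices m n" for u
    using ker[OF that] by (simp add: kasteleyn_row_def)
  define g where "g u = (case u of
      Beta s x y \<Rightarrow> triangle_gauge (\<lambda>s t. W0 (Beta s x y) (Beta t x y)) s
    | Omega s x y \<Rightarrow> triangle_gauge (\<lambda>s t. W0 (Omega s x y) (Omega t x y)) s)" for u
  have g: "g u > 0" for u
    by (cases u) (simp_all add: g_def triangle_gauge(1) W0)
  have "f u / of_real (g u) = 0"
  proof (rule kernel_trivial_normalised[where W = "\<lambda>u v. g u * W0 u v * g v" and z = z, OF m n])
    show "g u * W0 u v * g v > 0" for u v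
      by (simp add: g W0)
    show "g (Beta s x y) * W0 (Beta s x y) (Beta (next_dir s) x y) * g (Beta (next_dir s) x y) = 1" for s x y
      using triangle_gauge(2)[of "\<lambda>s t. W0 (Beta s x y) (Beta t x y)" s] by (simp add: g_def W0)
    show "g (Omega s x y) * W0 (Omega s x y) (Omega (next_dir s) x y) * g (Omega (next_dir s) x y) = 1" for s x y
      using triangle_gauge(2)[of "\<lambda>s t. W0 (Omega s x y) (Omega t x y)" s] by (simp add: g_def W0)
    show "kasteleyn_row m n (\<lambda>u v. g u * W0 u v * g v) z (\<lambda>v. f v / of_real (g v)) u = 0"
      if "u \<in> fisher_vertices m n" for u
      by (simp add: kasteleyn_row_gauge[OF g] ker0[OF that])
  qed (use z u in auto)
  then show ?thesis
    using g[of u] by simp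
qed

lemma char_fun_zero_imp_kernel:
  assumes "char_fun m n W z = 0"
  obtains f u where "u \<in> fisher_vertices m n" "f u \<noteq> 0"
    "\<And>v. v \<in> fisher_vertices m n \<Longrightarrow> kasteleyn_row m n W z f v = 0"
proof -
  define L where "L = 6 * m * n"
  let ?K = "kasteleyn_matrix m n W z" and ?v = "\<lambda>i. vertex_list m n ! i"
  have K: "?K \<in> carrier_mat L L"
    by (simp add: kasteleyn_matrix_def L_def)
  obtain x where x: "x \<in> carrier_vec L" "x \<noteq> 0\<^sub>v L" "?K *\<^sub>v x = 0\<^sub>v L"
    using det_0_iff_vec_prod_zero[OF K] assms unfolding char_fun_def by blast
  have bij: "bij_betw ?v {..<L} (fisher_vertices m n)"
    using bij_betw_nth[OF distinct_vertex_list[of m n]]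
    by (simp add: length_vertex_list set_vertex_list L_def)
  define f where "f = (\<lambda>u. x $ the_inv_into {..<L} ?v u)"
  have f: "f (?v i) = x $ i" if "i < L" for i
    using that bij by (simp add: f_def the_inv_into_f_f bij_betw_def)
  obtain i where i: "i < L" "x $ i \<noteq> 0"
    using x(1,2) by (metis carrier_vecD eq_vecI index_zero_vec(1) dim_vec index_zero_vec(2))
  have "kasteleyn_row m n W z f v = 0" if v: "v \<in> fisher_vertices m n" for v
  proof -
    obtain j where j: "j < L" "v = ?v j"
      using bij v by (auto simp: bij_betw_def)
    have "kasteleyn_row m n W z f v = (\<Sum>k<L. kasteleyn_entry m n W z v (?v k) * f (?v k))"
      unfolding kasteleyn_row_def by (rule sum.reindex_bij_betw[OF bij, symmetric])
    also have "\<dots> = (?K *\<^sub>v x) $ j"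
      using j x(1) K
      by (simp add: f kasteleyn_matrix_def L_def scalar_prod_def atLeast0LessThan)
    also have "\<dots> = 0"
      using j x(3) by simp
    finally show ?thesis .
  qed
  moreover have "?v i \<in> fisher_vertices m n"
    using bij i by (auto simp: bij_betw_def)
  ultimately show ?thesis
    using that[of "?v i" f] f i by simp
qed

theorem theorem1p1:
  fixes m n :: nat and W :: "vertex \<Rightarrow> vertex \<Rightarrow> real"
  assumes "m \<ge> 1" and "n \<ge> 1"
    and "\<And>u v. fisher_edge m n u v \<Longrightarrow> W u v > 0"
  shows "{z :: complex. char_fun m n W z = 0 \<and> cmod z = 1} \<in> {{}, {1}, {-1}}"
proof -
  have "z = (- 1) ^ n" if "char_fun m n W z = 0" "cmod z = 1" for z
  proof (rule ccontr)
    assume "z \<noteq> (- 1) ^ n"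
    then show False
      using char_fun_zero_imp_kernel[OF that(1)] kernel_trivial[of m n W z] assms that(2)
      by (metis Suc_le_eq One_nat_def)
  qed
  then have "{z. char_fun m n W z = 0 \<and> cmod z = 1} \<subseteq> {(- 1) ^ n}"
    by blast
  then show ?thesis
    by (cases "even n") (auto simp: subset_singleton_iff)
qed

end
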